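(* The subsets of $\mathbb{R}/\mathbb{Z} = S^1$ of the form $\mathrm{rot}(X(G,\alpha))$, where $G$ varies over all countable groups and $\alpha \in G$ is arbitrary, are precisely the nonempty closed subsets of a topology on $S^1$ (called the *representation topology* ). Moreover, the nonempty closed subsets in the representation topology on $S^1$ are exactly the unions $\{0\} \cup K$, where $K \subset \mathbb{R}/\mathbb{Z}$ is closed in the usual sense and invariant under $x \mapsto -x$.
   Context: $\mathrm{Homeo}^+(S^1)$ is the group of orientation-preserving homeomorphisms of the circle, and $\mathrm{rot}: \mathrm{Homeo}^+(S^1) \to \mathbb{R}/\mathbb{Z}$ is Poincaré's rotation number: $\mathrm{rot}(\alpha) = \lim_{n\to\infty} \tilde\alpha^n(0)/n \bmod \mathbb{Z}$ for any lift $\tilde\alpha \in \mathrm{Homeo}^+(\mathbb{R})$ of $\alpha$. For a countable group $G$ and $\alpha \in G$, $$\mathrm{rot}(X(G,\alpha)) = \{ r \in \mathbb{R}/\mathbb{Z} : r = \mathrm{rot}(\rho(\alpha)) \text{ for some } \rho \in \mathrm{Hom}(G, \mathrm{Homeo}^+(S^1))\}.$$ *)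

theory Defs
  imports "HOL-Analysis.Analysis" "HOL-Algebra.Group"
begin

quotient_type circle = real / "\<lambda>x y :: real. x - y \<in> \<int>"
proof (rule equivpI)
  show "reflp (\<lambda>x y :: real. x - y \<in> \<int>)"
    by (simp add: reflp_def)
  show "symp (\<lambda>x y :: real. x - y \<in> \<int>)"
    by (metis (no_types, lifting) Ints_minus minus_diff_eq sympI)
  show "transp (\<lambda>x y :: real. x - y \<in> \<int>)"
    by (rule transpI) (metis (no_types, lifting) Ints_add diff_add_cancel add_diff_eq)
qed

lift_definition to_circle :: "real \<Rightarrow> circle" is "\<lambda>x. x" .

lemma to_circle_eq_iff: "to_circle x = to_circle y \<longleftrightarrow> x - y \<in> \<int>"
  by transfer simp

lemma surj_to_circle: "surj to_circle"
  unfolding surj_def by transfer (metis Ints_0 diff_self)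

instantiation circle :: ab_group_add
begin

lift_definition zero_circle :: circle is 0 .

lift_definition plus_circle :: "circle \<Rightarrow> circle \<Rightarrow> circle" is "(+)"
  by (metis Ints_add add_diff_add)

lift_definition uminus_circle :: "circle \<Rightarrow> circle" is uminus
  by (metis Ints_minus minus_diff_minus)

lift_definition minus_circle :: "circle \<Rightarrow> circle \<Rightarrow> circle" is "(-)"
  by (metis Ints_diff diff_diff_eq2 diff_diff_add add.commute diff_add_eq)

instance
  by standard (transfer; simp)+

end

instantiation circle :: topological_space
begin

definition open_circle :: "circle set \<Rightarrow> bool"
  where "open_circle U \<longleftrightarrow> open (to_circle -` U)"

instance
proof
  show "open (UNIV :: circle set)"
    by (simp add: open_circle_def)
  show "open (S \<inter> T)" if "open S" "open T" for S T :: "circle set"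
    using that by (simp add: open_circle_def open_Int)
  show "open (\<Union>K)" if "\<forall>S\<in>K. open S" for K :: "circle set set"
    using that by (auto simp: open_circle_def vimage_Union)
qed

end

definition homeo_real_plus :: "(real \<Rightarrow> real) set"
  where "homeo_real_plus = {F. (\<exists>G. homeomorphism UNIV UNIV F G) \<and> strict_mono F}"

definition lifts :: "(circle \<Rightarrow> circle) \<Rightarrow> (real \<Rightarrow> real) set"
  where "lifts f = {F \<in> homeo_real_plus. \<forall>x. to_circle (F x) = f (to_circle x)}"

text \<open>A circle homeomorphism preserves orientation iff it lifts to an increasing homeomorphism of
  the line.  Commutation of a lift with the unit translation is not demanded, since it is automatic.\<close>

definition homeo_circle_plus :: "(circle \<Rightarrow> circle) monoid"
  where "homeo_circle_plus =
    \<lparr>carrier = {f. (\<exists>g. homeomorphism UNIV UNIV f g) \<and> lifts f \<noteq> {}},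
     monoid.mult = (\<circ>), one = id\<rparr>"

lemma group_homeo_circle_plus: "group homeo_circle_plus"
proof (rule groupI)
  fix f g assume f: "f \<in> carrier homeo_circle_plus" and g: "g \<in> carrier homeo_circle_plus"
  obtain f' g' where *: "homeomorphism UNIV UNIV f f'" "homeomorphism UNIV UNIV g g'"
    using f g by (auto simp: homeo_circle_plus_def)
  obtain F G F' G' where F: "homeomorphism UNIV UNIV F F'" "strict_mono F"
      "\<And>x. to_circle (F x) = f (to_circle x)"
    and G: "homeomorphism UNIV UNIV G G'" "strict_mono G"
      "\<And>x. to_circle (G x) = g (to_circle x)"
    using f g by (auto simp: homeo_circle_plus_def lifts_def homeo_real_plus_def)
  have "F \<circ> G \<in> lifts (f \<circ> g)"
    using homeomorphism_compose[OF G(1) F(1)] F(2,3) G(2,3)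
    by (auto simp: lifts_def homeo_real_plus_def strict_mono_def)
  then show "f \<otimes>\<^bsub>homeo_circle_plus\<^esub> g \<in> carrier homeo_circle_plus"
    using homeomorphism_compose[OF *(2,1)] by (auto simp: homeo_circle_plus_def)
next
  have "id \<in> lifts id"
    using homeomorphism_ident[of "UNIV :: real set"]
    by (auto simp: lifts_def homeo_real_plus_def strict_mono_def id_def)
  then show "\<one>\<^bsub>homeo_circle_plus\<^esub> \<in> carrier homeo_circle_plus"
    using homeomorphism_ident[of "UNIV :: circle set"]
    by (auto simp: homeo_circle_plus_def id_def)
next
  fix f assume f: "f \<in> carrier homeo_circle_plus"
  obtain f' where f': "homeomorphism UNIV UNIV f f'"
    using f by (auto simp: homeo_circle_plus_def)
  obtain F F' where F: "homeomorphism UNIV UNIV F F'" "strict_mono F"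
      "\<And>x. to_circle (F x) = f (to_circle x)"
    using f by (auto simp: homeo_circle_plus_def lifts_def homeo_real_plus_def)
  have inv: "F (F' x) = x" for x
    using F(1) by (simp add: homeomorphism_def)
  have "strict_mono F'"
    using F(2) inv by (metis strict_monoI strict_mono_less)
  moreover have "to_circle (F' x) = f' (to_circle x)" for x
    using F(3)[of "F' x"] f' inv by (metis homeomorphism_apply1 UNIV_I)
  ultimately have "F' \<in> lifts f'"
    using homeomorphism_symD[OF F(1)] by (auto simp: lifts_def homeo_real_plus_def)
  then have "f' \<in> carrier homeo_circle_plus"
    using homeomorphism_symD[OF f'] by (auto simp: homeo_circle_plus_def)
  moreover have "f' \<otimes>\<^bsub>homeo_circle_plus\<^esub> f = \<one>\<^bsub>homeo_circle_plus\<^esub>"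
    using f' by (auto simp: homeo_circle_plus_def homeomorphism_def)
  ultimately show "\<exists>g\<in>carrier homeo_circle_plus.
      g \<otimes>\<^bsub>homeo_circle_plus\<^esub> f = \<one>\<^bsub>homeo_circle_plus\<^esub>"
    by blast
qed (simp_all add: homeo_circle_plus_def comp_assoc)

text \<open>Only meaningful on the carrier of \<open>homeo_circle_plus\<close>; there, by Poincare's theorem, the limit
  exists for every lift and its class modulo the integers does not depend on the lift.\<close>

definition rot :: "(circle \<Rightarrow> circle) \<Rightarrow> circle"
  where "rot f = (THE r. \<forall>F\<in>lifts f. \<exists>t. (\<lambda>n. (F ^^ n) 0 / real n) \<longlonglongrightarrow> t \<and> r = to_circle t)"

definition rot_X :: "('g, 'm) monoid_scheme \<Rightarrow> 'g \<Rightarrow> circle set"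
  where "rot_X G a = {r. \<exists>\<rho> \<in> hom G homeo_circle_plus. r = rot (\<rho> a)}"

end

(*
Closedness.  Given a countable group acting on the circle, average the words in its elements with
rapidly decreasing weights: in the resulting coordinate every element g is C_g-Lipschitz, where C_g
does not depend on the action.  A sequence of such normalized actions therefore has a pointwise
limit action, and rotation numbers pass to the limit.

Realization.  In the modular group <u, v | u^2 = v^3 = 1>, the rotation number of uv lies in
(-1/3, 1/3) whenever u and v act nontrivially, while every rotation by s with |s| <= 1/6 is such a
product (in PSL(2,R), with uv elliptic).  Let K be closed and symmetric with 0 in K, and consider
tuples of rotations indexed by the points of K in [0, 1/2]; a tuple all of whose angles are at most
1/6 is again a product uv in a power of Homeo+.  Take the subgroup generated by countably many such
u and v.  In an arbitrary action of it the rotation number is additive on tuples of rotations, and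
the bound 1/3 makes it small on tuples of small angles.  On the tuples t 1_P, for the pieces P of a
partition of the index set into short intervals, this forces it to be 0 for all P with at most one
exception, where it is t or -t.  Hence the identity tuple (r)_r has rotation number close to
0 or to some r or -r with r in K.
*)

theory Submission
  imports Defs "HOL-Algebra.Generated_Groups"
begin

section \<open>Lifts of circle homeomorphisms\<close>

text \<open>A pointwise limit of circle homeomorphisms can collapse an interval. The constants C_g
  prevent this because they exist for every element and do not depend on the action: the bound for g
  makes the limit of g continuous, and since the inverse of g has a limit too, the limit of g is
  injective.

  In the realization the obstacle is that an arbitrary action need not respect the coordinates of a
  tuple and may kill u or v; then uv has order dividing 3 or 2 instead of a small rotation number.
  Smallness therefore comes from many products at once: if y, 2y, ..., ny all avoid the middle third
  of the circle, then y has size below 1/(3n), apart from a few torsion values, which vanish on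
  multiplication by 12. Two pieces P and Q cannot both be exceptional, because t(1_P + 1_Q) and
  t(1_P - 1_Q) are tuples of small angles as well, and one of them would have rotation number 2t or
  -2t.\<close>

definition deg1 :: "(real \<Rightarrow> real) \<Rightarrow> bool"
  where "deg1 F \<longleftrightarrow> continuous_on UNIV F \<and> strict_mono F \<and> (\<forall>x. F (x + 1) = F x + 1)"

lemma deg1_cont: "deg1 F \<Longrightarrow> continuous_on UNIV F"
  and deg1_strict_mono: "deg1 F \<Longrightarrow> strict_mono F"
  and deg1_one: "deg1 F \<Longrightarrow> F (x + 1) = F x + 1"
  by (auto simp: deg1_def)

lemma deg1_less_iff: "deg1 F \<Longrightarrow> F x < F y \<longleftrightarrow> x < y"
  by (simp add: deg1_strict_mono strict_mono_less)

lemma deg1_le_iff: "deg1 F \<Longrightarrow> F x \<le> F y \<longleftrightarrow> x \<le> y"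
  by (simp add: deg1_strict_mono strict_mono_less_eq)

lemma deg1_eq_iff: "deg1 F \<Longrightarrow> F x = F y \<longleftrightarrow> x = y"
  by (simp add: deg1_strict_mono strict_mono_eq)

lemma deg1_add_nat: "deg1 F \<Longrightarrow> F (x + of_nat k) = F x + of_nat k"
proof (induction k)
  case (Suc k)
  then show ?case using deg1_one[of F "x + of_nat k"] by (simp add: algebra_simps)
qed simp

lemma deg1_add_int:
  assumes "deg1 F"
  shows "F (x + of_int k) = F x + of_int k"
proof (cases "k \<ge> 0")
  case True
  then show ?thesis using deg1_add_nat[OF assms, of x "nat k"] by simp
next
  case False
  then show ?thesis using deg1_add_nat[OF assms, of "x + of_int k" "nat (- k)"] by simp
qed

lemma deg1_id [simp]: "deg1 (\<lambda>x. x)" "deg1 id"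
  by (auto simp: deg1_def strict_mono_def id_def continuous_on_id)

lemma deg1_translation [simp]: "deg1 (\<lambda>x. x + c)" "deg1 (\<lambda>x. x - c)"
  by (auto simp: deg1_def strict_mono_def intro!: continuous_intros)

lemma deg1_compose: "deg1 F \<Longrightarrow> deg1 G \<Longrightarrow> deg1 (F \<circ> G)"
  unfolding deg1_def
  by (auto simp: strict_mono_def intro: continuous_on_compose2)

lemma deg1_shift: "deg1 F \<Longrightarrow> deg1 (\<lambda>x. F x + c)"
  using deg1_compose[OF deg1_translation(1), of F c] by (simp add: comp_def)

lemma deg1_funpow: "deg1 F \<Longrightarrow> deg1 (F ^^ n)"
  by (induction n) (auto intro: deg1_compose simp: id_def[symmetric])

text \<open>Displacement is unchanged by integer shifts of the argument, so both points may be taken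
  within distance 1 of each other, where monotonicity applies. The universal constant 1 is behind
  all bounds on iterates below.\<close>

lemma deg1_displacement:
  assumes F: "deg1 F"
  shows "\<bar>(F x - x) - (F y - y)\<bar> < 1"
proof -
  define k where "k = \<lfloor>x - y\<rfloor>"
  have k: "y + of_int k \<le> x" "x < y + of_int (k + 1)"
    unfolding k_def by linarith+
  have "F y + of_int k \<le> F x" "F x < F y + of_int (k + 1)"
    using k deg1_add_int[OF F] deg1_le_iff[OF F] deg1_less_iff[OF F] by metis+
  then show ?thesis using k by auto
qed

lemma deg1_surj:
  assumes F: "deg1 F"
  shows "\<exists>x. F x = y"
proof -
  define k where "k = \<lfloor>y - F 0\<rfloor>"
  have "F (of_int k) \<le> y" "y \<le> F (of_int (k + 1))"
    using deg1_add_int[OF F, of 0 k] deg1_add_int[OF F, of 0 "k + 1"]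
    unfolding k_def by (simp_all, linarith+)
  moreover have "of_int k \<le> (of_int (k + 1) :: real)" by simp
  ultimately show ?thesis
    using IVT'[of F "of_int k" y "of_int (k + 1)"] deg1_cont[OF F] continuous_on_subset by blast
qed

lemma homeomorphism_UNIV_I:
  assumes "continuous_on UNIV f" "continuous_on UNIV g" "\<And>x. f (g x) = x" "\<And>x. g (f x) = x"
  shows "homeomorphism UNIV UNIV f g"
  using assms by (auto simp: homeomorphism_def intro!: surjI[of f g] surjI[of g f])

lemma deg1_inverse:
  assumes F: "deg1 F"
  shows "\<exists>G. deg1 G \<and> (\<forall>x. F (G x) = x) \<and> (\<forall>x. G (F x) = x)"
proof -
  define G where "G y = (THE x. F x = y)" for y
  have GF: "G (F x) = x" for x
    unfolding G_def using deg1_eq_iff[OF F] by auto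
  have FG: "F (G y) = y" for y
    using deg1_surj[OF F, of y] GF by metis
  have sm: "strict_mono G"
    unfolding strict_mono_def using deg1_less_iff[OF F] FG by metis
  have "isCont G (F x)" for x
    by (rule isCont_inverse_function[where d = 1])
      (use GF deg1_cont[OF F] in \<open>auto simp: continuous_on_eq_continuous_at\<close>)
  then have cont: "continuous_on UNIV G"
    using FG by (metis continuous_at_imp_continuous_on)
  have "G (x + 1) = G x + 1" for x
    using deg1_one[OF F, of "G x"] FG GF by metis
  then have "deg1 G" using sm cont by (simp add: deg1_def)
  then show ?thesis using FG GF by blast
qed

section \<open>The projection to the circle and the descent of lifts\<close>

lemma to_circle_eq_0_iff: "to_circle x = 0 \<longleftrightarrow> x \<in> \<int>"
  using to_circle_eq_iff[of x 0] by (simp add: zero_circle_def to_circle_def map_fun_def zero_circle.abs_eq)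

lemma to_circle_0: "to_circle 0 = 0"
  by (simp add: to_circle_eq_0_iff)

lemma to_circle_add: "to_circle (x + y) = to_circle x + to_circle y"
  by transfer simp

lemma to_circle_minus: "to_circle (- x) = - to_circle x"
  by transfer simp

lemma to_circle_add_int [simp]: "to_circle (x + of_int k) = to_circle x"
  by (simp add: to_circle_eq_iff)

lemma to_circle_cases: obtains x where "c = to_circle x"
  using surj_to_circle by (metis surj_def)

lemma to_circle_eqE:
  assumes "to_circle x = to_circle y" obtains k :: int where "x = y + of_int k"
  using assms unfolding to_circle_eq_iff Ints_def by (auto simp: algebra_simps)

lemma closed_circle_iff: "closed K \<longleftrightarrow> closed (to_circle -` K)"
  by (simp add: closed_def open_circle_def vimage_Compl)

text \<open>\<open>inv_into\<close> picks some preimage of \<open>c\<close>. For maps satisfying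
  \<open>deg1\<close> the choice does not matter, by \<open>circ_to_circle\<close>, and
  \<open>circ F\<close> is the circle map that \<open>F\<close> lifts.\<close>

definition circ :: "(real \<Rightarrow> real) \<Rightarrow> circle \<Rightarrow> circle"
  where "circ F c = to_circle (F (inv_into UNIV to_circle c))"

lemma circ_to_circle:
  assumes "deg1 F"
  shows "circ F (to_circle x) = to_circle (F x)"
proof -
  have "to_circle (inv_into UNIV to_circle (to_circle x)) = to_circle x"
    by (simp add: surj_f_inv_f surj_to_circle)
  then obtain k where "inv_into UNIV to_circle (to_circle x) = x + of_int k"
    by (rule to_circle_eqE)
  then show ?thesis unfolding circ_def by (simp add: deg1_add_int[OF assms])
qed

lemma circ_unique:
  assumes "deg1 F" "\<And>x. f (to_circle x) = to_circle (F x)"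
  shows "f = circ F"
  using assms circ_to_circle by (metis ext to_circle_cases)

lemma circ_compose:
  assumes "deg1 F" "deg1 G"
  shows "circ F \<circ> circ G = circ (F \<circ> G)"
  by (rule circ_unique) (simp_all add: assms deg1_compose circ_to_circle)

lemma circ_id: "circ (\<lambda>x. x) = id"
  by (rule circ_unique[symmetric]) simp_all

lemma circ_add_int:
  assumes "deg1 F"
  shows "circ (\<lambda>x. F x + of_int k) = circ F"
  by (rule circ_unique) (simp_all add: assms deg1_shift circ_to_circle)

text \<open>The difference of two lifts is continuous with integer values, hence constant.\<close>

lemma circ_eq_iff:
  assumes F: "deg1 F" and G: "deg1 G"
  shows "circ F = circ G \<longleftrightarrow> (\<exists>k::int. \<forall>x. F x = G x + of_int k)"
proof
  assume eq: "circ F = circ G"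
  define D where "D x = F x - G x" for x
  have Z: "D x \<in> \<int>" for x
    using eq circ_to_circle[OF F, of x] circ_to_circle[OF G, of x] unfolding D_def
    by (simp flip: to_circle_eq_iff)
  have "continuous_on UNIV D"
    unfolding D_def by (intro continuous_intros deg1_cont F G)
  moreover have "\<exists>e>0. \<forall>y. y \<in> UNIV \<and> D y \<noteq> D x \<longrightarrow> e \<le> norm (D y - D x)" for x
  proof (intro exI[of _ 1] conjI allI impI)
    fix y assume y: "y \<in> UNIV \<and> D y \<noteq> D x"
    obtain m n :: int where "D x = of_int m" "D y = of_int n"
      using Z[of x] Z[of y] by (auto elim!: Ints_cases)
    then show "1 \<le> norm (D y - D x)"
      using y by (simp flip: of_int_diff)
  qed simp
  ultimately have "D constant_on UNIV"
    by (intro continuous_discrete_range_constant) auto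
  then obtain c where "\<And>x. D x = c" unfolding constant_on_def by auto
  with Z[of 0] obtain k :: int where "\<And>x. D x = of_int k" by (metis Ints_cases)
  then have "\<forall>x. F x = G x + of_int k" unfolding D_def by (metis add.commute diff_add_cancel)
  then show "\<exists>k::int. \<forall>x. F x = G x + of_int k" ..
next
  assume "\<exists>k::int. \<forall>x. F x = G x + of_int k"
  then obtain k :: int where "F = (\<lambda>x. G x + of_int k)" by auto
  then show "circ F = circ G" using circ_add_int[OF G] by simp
qed

lemma circ_continuous:
  assumes F: "deg1 F"
  shows "continuous_on UNIV (circ F)"
proof (clarsimp simp: continuous_on_open_vimage)
  fix B :: "circle set" assume "open B"
  moreover have "to_circle -` (circ F -` B) = F -` (to_circle -` B)"
    by (auto simp: circ_to_circle[OF F])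
  ultimately show "open (circ F -` B)"
    using deg1_cont[OF F] by (simp add: open_circle_def continuous_on_open_vimage)
qed

lemma circ_inverse:
  assumes "deg1 F" "deg1 G" "\<And>x. F (G x) = x"
  shows "circ F (circ G c) = c"
proof -
  have "F \<circ> G = (\<lambda>x. x)" using assms(3) by auto
  then show ?thesis using circ_compose[OF assms(1,2)] circ_id by (metis comp_apply id_apply)
qed

lemma lifts_circ:
  assumes "deg1 F"
  shows "F \<in> lifts (circ F)"
proof -
  obtain G where G: "deg1 G" "\<And>x. F (G x) = x" "\<And>x. G (F x) = x"
    using deg1_inverse[OF assms] by metis
  then have "homeomorphism UNIV UNIV F G"
    by (intro homeomorphism_UNIV_I deg1_cont assms)
  then show ?thesis
    using deg1_strict_mono[OF assms] circ_to_circle[OF assms]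
    by (auto simp: lifts_def homeo_real_plus_def)
qed

lemma circ_in_carrier:
  assumes F: "deg1 F"
  shows "circ F \<in> carrier homeo_circle_plus"
proof -
  obtain G where G: "deg1 G" "\<And>x. F (G x) = x" "\<And>x. G (F x) = x"
    using deg1_inverse[OF F] by metis
  have "circ F (circ G c) = c" "circ G (circ F c) = c" for c
    by (simp_all add: circ_inverse F G)
  then have "homeomorphism UNIV UNIV (circ F) (circ G)"
    by (intro homeomorphism_UNIV_I circ_continuous F G(1))
  then show ?thesis using lifts_circ[OF F] by (auto simp: homeo_circle_plus_def)
qed

text \<open>Commutation with the unit translation is forced by injectivity of \<open>f\<close>: the
  difference \<open>F (x + 1) - F x\<close> is a positive integer, and if it were 2 or more,
  \<open>F\<close> would take the value \<open>F x + 1\<close> strictly inside the period, so that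
  \<open>f\<close> would identify two points.\<close>

lemma lifts_deg1:
  assumes f: "f \<in> carrier homeo_circle_plus" and F: "F \<in> lifts f"
  shows "deg1 F" "f = circ F"
proof -
  obtain g where "homeomorphism UNIV UNIV f g" using f by (auto simp: homeo_circle_plus_def)
  then have inj: "inj f" unfolding homeomorphism_def by (metis UNIV_I injI)
  have sm: "strict_mono F" and cont: "continuous_on UNIV F" and lift: "\<And>x. to_circle (F x) = f (to_circle x)"
    using F by (auto simp: lifts_def homeo_real_plus_def homeomorphism_def)
  have "F (x + 1) = F x + 1" for x
  proof -
    have "to_circle (F (x + 1)) = to_circle (F x)"
      using lift to_circle_add_int[of x 1] by simp
    then obtain k where k: "F (x + 1) = F x + of_int k" by (rule to_circle_eqE)
    have "F x < F (x + 1)" using sm by (simp add: strict_mono_less)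
    then have "k \<ge> 1" using k by simp
    moreover have False if "k \<ge> 2"
    proof -
      have "F x \<le> F x + 1" "F x + 1 \<le> F (x + 1)" using k that by auto
      then obtain y where y: "x \<le> y" "y \<le> x + 1" "F y = F x + 1"
        using IVT'[of F x "F x + 1" "x + 1"] cont continuous_on_subset by (metis le_add_same_cancel1 subset_UNIV zero_le_one)
      have "f (to_circle y) = f (to_circle x)"
        using y(3) lift to_circle_add_int[of "F x" 1] by (metis of_int_1)
      then have "to_circle y = to_circle x" using inj by (simp add: inj_eq)
      then obtain m where m: "y = x + of_int m" by (rule to_circle_eqE)
      then have "m = 0 \<or> m = 1" using y by auto
      then show False using m y k that by auto
    qed
    ultimately show ?thesis using k by force
  qed
  then show d: "deg1 F" using sm cont by (simp add: deg1_def)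
  show "f = circ F" by (rule circ_unique[OF d]) (simp add: lift)
qed

lemma carrier_homeo_circle_plus: "carrier homeo_circle_plus = circ ` Collect deg1"
proof
  show "carrier homeo_circle_plus \<subseteq> circ ` Collect deg1"
  proof
    fix f assume f: "f \<in> carrier homeo_circle_plus"
    then obtain F where "F \<in> lifts f" by (auto simp: homeo_circle_plus_def)
    then show "f \<in> circ ` Collect deg1" using lifts_deg1[OF f] by blast
  qed
qed (auto intro: circ_in_carrier)

lemma homeo_circle_plus_mult [simp]: "f \<otimes>\<^bsub>homeo_circle_plus\<^esub> g = f \<circ> g"
  and homeo_circle_plus_one [simp]: "\<one>\<^bsub>homeo_circle_plus\<^esub> = id"
  by (simp_all add: homeo_circle_plus_def)

section \<open>Translation numbers\<close>

definition trans_num :: "(real \<Rightarrow> real) \<Rightarrow> real"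
  where "trans_num F = lim (\<lambda>n. (F ^^ n) 0 / real n)"

lemma funpow_displacement:
  assumes F: "deg1 F"
  shows "\<bar>((F ^^ n) x - x) - (F ^^ n) 0\<bar> < 1"
  using deg1_displacement[OF deg1_funpow[OF F], of n x 0] by simp

text \<open>Each of the \<open>m\<close> blocks of \<open>n\<close> iterations moves its starting
  point by \<open>(F ^^ n) 0\<close> up to an error below 1.\<close>

lemma funpow_quasi_additive:
  assumes F: "deg1 F"
  shows "\<bar>(F ^^ (m * n)) 0 - real m * (F ^^ n) 0\<bar> \<le> real m"
proof (induction m)
  case (Suc m)
  have "(F ^^ (Suc m * n)) 0 = (F ^^ n) ((F ^^ (m * n)) 0)"
    by (simp add: funpow_add)
  then show ?case using Suc funpow_displacement[OF F, of n "(F ^^ (m * n)) 0"]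
    by (simp add: algebra_simps)
qed simp

lemma trans_num_lim:
  assumes F: "deg1 F"
  shows "(\<lambda>n. (F ^^ n) 0 / real n) \<longlonglongrightarrow> trans_num F"
proof -
  define a where "a n = (F ^^ n) 0" for n
  \<comment> \<open>Both quotients are compared with the quotient at index
    \<open>m * n\<close>.\<close>
  have close: "\<bar>a n / real n - a m / real m\<bar> \<le> 1 / real n + 1 / real m" if "n > 0" "m > 0" for m n
  proof -
    have "\<bar>a (k * l) / (real k * real l) - a l / real l\<bar> \<le> 1 / real l" if "k > 0" "l > 0" for k l
    proof -
      have "a (k * l) / (real k * real l) - a l / real l = (a (k * l) - real k * a l) / (real k * real l)"
        using that by (simp add: field_simps)
      also have "\<bar>\<dots>\<bar> \<le> real k / (real k * real l)"
        unfolding abs_divide using funpow_quasi_additive[OF F, of k l] that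
        by (intro frac_le) (auto simp: a_def)
      finally show ?thesis using that by simp
    qed
    from this[of m n] this[of n m] that show ?thesis
      by (simp add: mult.commute)
  qed
  have "Cauchy (\<lambda>n. a n / real n)"
  proof (rule metric_CauchyI)
    fix e :: real assume e: "e > 0"
    obtain N where N: "N > 0" "1 / real N < e / 2"
      using e by (metis half_gt_zero inverse_eq_divide reals_Archimedean zero_less_Suc)
    have "dist (a m / real m) (a n / real n) < e" if "m \<ge> N" "n \<ge> N" for m n
    proof -
      have "1 / real m \<le> 1 / real N" "1 / real n \<le> 1 / real N"
        using that N(1) by (auto intro!: divide_left_mono)
      then show ?thesis using close[of m n] that N by (simp add: dist_real_def)
    qed
    then show "\<exists>M. \<forall>m\<ge>M. \<forall>n\<ge>M. dist (a m / real m) (a n / real n) < e" by blast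
  qed
  then have "convergent (\<lambda>n. a n / real n)" by (simp add: Cauchy_convergent)
  then show ?thesis unfolding trans_num_def a_def by (simp add: convergent_LIMSEQ_iff)
qed

lemma trans_num_eqI:
  assumes F: "deg1 F" and bound: "\<And>n. \<bar>(F ^^ n) 0 - real n * t\<bar> \<le> C"
  shows "trans_num F = t"
proof -
  have "(\<lambda>n. (F ^^ n) 0 / real n - t) \<longlonglongrightarrow> 0"
  proof (rule Lim_null_comparison)
    show "\<forall>\<^sub>F n in sequentially. norm ((F ^^ n) 0 / real n - t) \<le> C / real n"
      using eventually_gt_at_top[of 0]
    proof eventually_elim
      case (elim n)
      then have "(F ^^ n) 0 / real n - t = ((F ^^ n) 0 - real n * t) / real n"
        by (simp add: field_simps)
      then show ?case using bound[of n] elim by (simp add: divide_right_mono)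
    qed
    show "(\<lambda>n. C / real n) \<longlonglongrightarrow> 0" by (rule lim_const_over_n)
  qed
  then have "(\<lambda>n. (F ^^ n) 0 / real n) \<longlonglongrightarrow> t" by (simp add: LIM_zero_iff)
  then show ?thesis using trans_num_lim[OF F] LIMSEQ_unique by blast
qed

text \<open>This is \<open>funpow_quasi_additive\<close> with the number of blocks tending to
  infinity. The error depends neither on \<open>F\<close> nor on \<open>n\<close>, which is what
  makes translation numbers pass to pointwise limits.\<close>

lemma trans_num_bound:
  assumes F: "deg1 F"
  shows "\<bar>(F ^^ n) 0 - real n * trans_num F\<bar> \<le> 1"
proof (cases "n = 0")
  case False
  have "(\<lambda>m. (F ^^ (m * n)) 0 / real m) \<longlonglongrightarrow> real n * trans_num F"
  proof -
    have "(\<lambda>m. (F ^^ (m * n)) 0 / real (m * n)) \<longlonglongrightarrow> trans_num F"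
      using LIMSEQ_subseq_LIMSEQ[OF trans_num_lim[OF F], of "\<lambda>m. m * n"] False
      by (auto simp: strict_mono_def comp_def)
    from tendsto_mult_left[OF this, of "real n"] show ?thesis using False
      by (simp add: field_simps)
  qed
  from tendsto_rabs[OF tendsto_diff[OF tendsto_const this]]
  have "(\<lambda>m. \<bar>(F ^^ n) 0 - (F ^^ (m * n)) 0 / real m\<bar>) \<longlonglongrightarrow> \<bar>(F ^^ n) 0 - real n * trans_num F\<bar>" .
  moreover have "\<forall>\<^sub>F m in sequentially. \<bar>(F ^^ n) 0 - (F ^^ (m * n)) 0 / real m\<bar> \<le> 1"
    using eventually_gt_at_top[of 0]
  proof eventually_elim
    case (elim m)
    then have "(F ^^ n) 0 - (F ^^ (m * n)) 0 / real m = - ((F ^^ (m * n)) 0 - real m * (F ^^ n) 0) / real m"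
      by (simp add: field_simps)
    then show ?case using funpow_quasi_additive[OF F, of m n] elim by simp
  qed
  ultimately show ?thesis by (rule tendsto_upperbound) simp
qed simp

lemma funpow_commute:
  assumes "\<And>x. F (G x) = G (F x)"
  shows "(F ^^ n) (G x) = G ((F ^^ n) x)"
  by (induction n) (simp_all add: assms)

lemma funpow_compose_commute:
  assumes "\<And>x. F (G x) = G (F x)"
  shows "((F \<circ> G) ^^ n) x = (F ^^ n) ((G ^^ n) x)"
proof (induction n)
  case (Suc n)
  then show ?case using funpow_commute[of F G n, OF assms] by simp
qed simp

lemma trans_num_compose_commute:
  assumes F: "deg1 F" and G: "deg1 G" and comm: "\<And>x. F (G x) = G (F x)"
  shows "trans_num (F \<circ> G) = trans_num F + trans_num G"
proof (rule trans_num_eqI)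
  show "deg1 (F \<circ> G)" by (rule deg1_compose[OF F G])
  fix n
  have "\<bar>(F ^^ n) ((G ^^ n) 0) - (F ^^ n) 0 - (G ^^ n) 0\<bar> \<le> 1"
    using funpow_displacement[OF F, of n "(G ^^ n) 0"] by simp
  then show "\<bar>((F \<circ> G) ^^ n) 0 - real n * (trans_num F + trans_num G)\<bar> \<le> 3"
    using trans_num_bound[OF F, of n] trans_num_bound[OF G, of n]
    unfolding funpow_compose_commute[of F G, OF comm] by (simp add: algebra_simps)
qed

lemma trans_num_translation: "trans_num (\<lambda>x. x + c) = c"
proof (rule trans_num_eqI)
  fix n
  have "((\<lambda>x. x + c) ^^ n) 0 = real n * c" by (induction n) (auto simp: algebra_simps)
  then show "\<bar>((\<lambda>x. x + c) ^^ n) 0 - real n * c\<bar> \<le> 0" by simp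
qed simp

lemma trans_num_add_int:
  assumes F: "deg1 F"
  shows "trans_num (\<lambda>x. F x + of_int k) = trans_num F + of_int k"
  using trans_num_compose_commute[OF F deg1_translation(1), of "of_int k"]
  by (simp add: comp_def deg1_add_int[OF F] trans_num_translation)

lemma trans_num_funpow:
  assumes F: "deg1 F"
  shows "trans_num (F ^^ n) = real n * trans_num F"
proof (induction n)
  case 0
  show ?case using trans_num_translation[of 0] by (simp add: id_def)
next
  case (Suc n)
  then show ?case
    using trans_num_compose_commute[OF F deg1_funpow[OF F, of n]] funpow_commute[of F F n]
    by (simp add: algebra_simps comp_def)
qed

text \<open>\<open>P\<close> moves all points by the same amount up to an error below 1, so
  corresponding orbits stay at bounded distance.\<close>

lemma trans_num_conj:
  assumes F: "deg1 F" and G: "deg1 G" and P: "deg1 P" and conj: "\<And>x. P (F x) = G (P x)"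
  shows "trans_num F = trans_num G"
proof (rule trans_num_eqI[OF F])
  fix n
  have "P ((F ^^ n) 0) = (G ^^ n) (P 0)" by (induction n) (simp_all add: conj)
  moreover have "\<bar>(P ((F ^^ n) 0) - (F ^^ n) 0) - (P 0 - 0)\<bar> < 1" by (rule deg1_displacement[OF P])
  ultimately show "\<bar>(F ^^ n) 0 - real n * trans_num G\<bar> \<le> 3"
    using funpow_displacement[OF G, of n "P 0"] trans_num_bound[OF G, of n] by linarith
qed

text \<open>\<open>G\<close> itself conjugates \<open>F \<circ> G\<close> to
  \<open>G \<circ> F\<close>.\<close>

lemma trans_num_compose_swap:
  assumes F: "deg1 F" and G: "deg1 G"
  shows "trans_num (F \<circ> G) = trans_num (G \<circ> F)"
  by (rule trans_num_conj[OF deg1_compose[OF F G] deg1_compose[OF G F] G]) simp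

lemma trans_num_inverse:
  assumes F: "deg1 F" and G: "deg1 G" and inv: "\<And>x. F (G x) = x" "\<And>x. G (F x) = x"
  shows "trans_num G = - trans_num F"
proof -
  have "F \<circ> G = (\<lambda>x. x + 0)" using inv by auto
  then have "trans_num (F \<circ> G) = 0" using trans_num_translation[of 0] by simp
  then show ?thesis using trans_num_compose_commute[OF F G] inv by simp
qed

lemma trans_num_reflect:
  assumes F: "deg1 F"
  shows "deg1 (\<lambda>x. - F (- x))" "trans_num (\<lambda>x. - F (- x)) = - trans_num F"
proof -
  have *: "- F (- (x + 1)) = - F (- x) + 1" for x
    using deg1_one[OF F, of "- x - 1"] by simp
  have "continuous_on UNIV (\<lambda>x. - F (- x))"
    by (intro continuous_intros continuous_on_compose2[OF deg1_cont[OF F]]) auto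
  then show d: "deg1 (\<lambda>x. - F (- x))"
    using * by (auto simp: deg1_def strict_mono_def deg1_less_iff[OF F])
  have pow: "((\<lambda>x. - F (- x)) ^^ n) 0 = - (F ^^ n) 0" for n by (induction n) simp_all
  show "trans_num (\<lambda>x. - F (- x)) = - trans_num F"
  proof (rule trans_num_eqI[OF d])
    show "\<bar>((\<lambda>x. - F (- x)) ^^ n) 0 - real n * - trans_num F\<bar> \<le> 1" for n
      using trans_num_bound[OF F, of n] by (simp add: pow)
  qed
qed

lemma trans_num_le_0:
  assumes F: "deg1 F" and x: "F x \<le> x"
  shows "trans_num F \<le> 0"
proof -
  have "(F ^^ n) x \<le> x" for n
  proof (induction n)
    case (Suc n)
    then show ?case using deg1_le_iff[OF F, of "(F ^^ n) x" x] x by simp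
  qed simp
  note below = this
  have "real n * trans_num F \<le> 2" for n
    using below[of n] funpow_displacement[OF F, of n x] trans_num_bound[OF F, of n] by linarith
  then show ?thesis
    by (metis linorder_not_less reals_Archimedean3)
qed

lemma trans_num_ge_0:
  assumes F: "deg1 F" and x: "F x \<ge> x"
  shows "trans_num F \<ge> 0"
  using trans_num_le_0[OF trans_num_reflect(1)[OF F], of "- x"] trans_num_reflect(2)[OF F] x by simp

text \<open>Strictness survives the limit because the displacement is periodic and attains its
  maximum on a period, so it is bounded by a constant below 1.\<close>

lemma trans_num_less_1:
  assumes F: "deg1 F" and less: "\<And>x. F x < x + 1"
  shows "trans_num F < 1"
proof -
  have cont: "continuous_on {0..1} (\<lambda>x. F x - x)"
    by (intro continuous_on_diff continuous_on_id continuous_on_subset[OF deg1_cont[OF F]]) simp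
  have "{0..1::real} \<noteq> {}" by simp
  from continuous_attains_sup[OF compact_Icc this cont]
  obtain z where z: "\<forall>x\<in>{0..1}. F x - x \<le> F z - z" by blast
  define c where "c = F z - z"
  have "F x \<le> x + c" for x
  proof -
    have "F (frac x) - frac x \<le> c" unfolding c_def by (rule bspec[OF z]) (simp add: frac_lt_1 less_imp_le)
    then show ?thesis using deg1_add_int[OF F, of "frac x" "\<lfloor>x\<rfloor>"] by (simp add: frac_def)
  qed
  note c = this
  have "(F ^^ n) 0 \<le> real n * c" for n
  proof (induction n)
    case (Suc n)
    then show ?case using c[of "(F ^^ n) 0"] by (simp add: algebra_simps)
  qed simp
  then have "(F ^^ n) 0 / real n \<le> c" if "n > 0" for n using that by (simp add: field_simps)
  then have "trans_num F \<le> c"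
    by (intro tendsto_upperbound[OF trans_num_lim[OF F]] eventually_sequentiallyI[of 1]) auto
  then show ?thesis using less[of z] unfolding c_def by linarith
qed

lemma rot_circ:
  assumes F: "deg1 F"
  shows "rot (circ F) = to_circle (trans_num F)"
  unfolding rot_def
proof (rule the_equality)
  show "\<forall>G\<in>lifts (circ F). \<exists>t. (\<lambda>n. (G ^^ n) 0 / real n) \<longlonglongrightarrow> t \<and> to_circle (trans_num F) = to_circle t"
  proof
    fix G assume "G \<in> lifts (circ F)"
    then have G: "deg1 G" "circ F = circ G" using lifts_deg1 circ_in_carrier[OF F] by blast+
    then obtain k :: int where "\<And>x. F x = G x + of_int k" using circ_eq_iff[OF F] by metis
    then have "F = (\<lambda>x. G x + of_int k)" by auto
    then have "trans_num F = trans_num G + of_int k" using trans_num_add_int[OF G(1)] by simp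
    then show "\<exists>t. (\<lambda>n. (G ^^ n) 0 / real n) \<longlonglongrightarrow> t \<and> to_circle (trans_num F) = to_circle t"
      using trans_num_lim[OF G(1)] by auto
  qed
next
  fix r
  assume "\<forall>G\<in>lifts (circ F). \<exists>t. (\<lambda>n. (G ^^ n) 0 / real n) \<longlonglongrightarrow> t \<and> r = to_circle t"
  then show "r = to_circle (trans_num F)"
    using lifts_circ[OF F] trans_num_lim[OF F] LIMSEQ_unique by metis
qed

text \<open>The lifts commute up to an integer translation, and that integer is 0 because
  \<open>F \<circ> G\<close> and \<open>G \<circ> F\<close> have the same translation
  number.\<close>

lemma circ_commute_lift:
  assumes F: "deg1 F" and G: "deg1 G" and comm: "circ F \<circ> circ G = circ G \<circ> circ F"
  shows "F (G x) = G (F x)"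
proof -
  have "circ (F \<circ> G) = circ (G \<circ> F)" using comm circ_compose F G by metis
  then obtain k :: int where k: "\<And>x. (F \<circ> G) x = (G \<circ> F) x + of_int k"
    using circ_eq_iff deg1_compose F G by metis
  then have "F \<circ> G = (\<lambda>x. (G \<circ> F) x + of_int k)" by auto
  then have "trans_num (F \<circ> G) = trans_num (G \<circ> F) + of_int k"
    using trans_num_add_int[OF deg1_compose[OF G F]] by simp
  then have "k = 0" using trans_num_compose_swap[OF F G] by simp
  then show ?thesis using k[of x] by simp
qed

lemma rot_compose_commute:
  assumes "f \<in> carrier homeo_circle_plus" "g \<in> carrier homeo_circle_plus" "f \<circ> g = g \<circ> f"
  shows "rot (f \<circ> g) = rot f + rot g"
proof -
  obtain F G where F: "deg1 F" "f = circ F" and G: "deg1 G" "g = circ G"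
    using assms by (auto simp: carrier_homeo_circle_plus)
  have "F (G x) = G (F x)" for x
    using circ_commute_lift[OF F(1) G(1)] assms(3) F(2) G(2) by simp
  from trans_num_compose_commute[OF F(1) G(1) this] show ?thesis
    by (simp add: F(2) G(2) circ_compose F(1) G(1) rot_circ deg1_compose to_circle_add)
qed

lemma rot_id: "rot id = 0"
  using rot_circ[of "\<lambda>x. x"] trans_num_translation[of 0] by (simp add: circ_id to_circle_0)

section \<open>Actions of the modular group\<close>

text \<open>An increasing map of the line has no finite orbits except fixed points. Nontrivial
  torsion on the circle is thus visible only as a power of a lift being a nonzero
  translation.\<close>

lemma deg1_square_id:
  assumes F: "deg1 F" and "F (F x) = x"
  shows "F x = x"
  using assms(2) deg1_less_iff[OF F, of x "F x"] deg1_less_iff[OF F, of "F x" x] by auto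

lemma deg1_cube_id:
  assumes F: "deg1 F" and "F (F (F x)) = x"
  shows "F x = x"
  using assms(2) deg1_less_iff[OF F, of x "F x"] deg1_less_iff[OF F, of "F x" x]
    deg1_less_iff[OF F, of "F x" "F (F x)"] deg1_less_iff[OF F, of "F (F x)" "F x"] by auto

text \<open>Everything follows from comparing \<open>U\<close> and \<open>V\<close> pointwise. If
  \<open>U\<close> were below \<open>V\<close> everywhere, then \<open>U\<close> applied twice would
  be below \<open>V\<close> applied three times, but both are the unit translation; so somewhere
  \<open>V x \<le> U x\<close>, which gives a point not moved to the left by \<open>Z\<close>. If
  also \<open>U x \<le> V x\<close> somewhere, then \<open>Z\<close> has translation number 0.
  Otherwise \<open>V\<close> is below \<open>U\<close> everywhere, whence \<open>Z\<close> is below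
  \<open>V\<close> and its cube below the unit translation.\<close>

lemma trans_num_modular:
  assumes U: "deg1 U" "\<And>x. U (U x) = x + 1" and V: "deg1 V" "\<And>x. V (V (V x)) = x + 1"
  shows "2 / 3 < trans_num (U \<circ> V)" "trans_num (U \<circ> V) \<le> 1"
proof -
  define X where "X = U \<circ> V"
  \<comment> \<open>As \<open>V\<^sup>3\<close> is the unit translation, \<open>Z\<close> is the inverse of \<open>V\<close> after \<open>U\<close>.\<close>
  define Z where "Z = (\<lambda>x. V (V (U x)) + of_int (-1))"
  define N where "N = (\<lambda>x. Z x + of_int (-1))"
  have X: "deg1 X" unfolding X_def by (intro deg1_compose U V)
  have Z: "deg1 Z" unfolding Z_def
    using deg1_shift[OF deg1_compose[OF V(1) deg1_compose[OF V(1) U(1)]], of "of_int (-1)"]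
    by (simp add: comp_def)
  have N: "deg1 N" unfolding N_def by (intro deg1_shift Z)
  note ints = deg1_add_int[OF U(1), of _ "-1"] deg1_add_int[OF V(1), of _ "-1"]
    deg1_add_int[OF U(1), of _ "-2"] deg1_add_int[OF V(1), of _ "-2"]
    deg1_one[OF U(1)] deg1_one[OF V(1)]
  have "X (N x) = x" for x
    using ints U(2) V(2) by (simp add: X_def N_def Z_def)
  moreover have "N (X x) = x" for x
    using ints U(2) V(2) by (simp add: X_def N_def Z_def)
  ultimately have "trans_num N = - trans_num X" by (intro trans_num_inverse X N) auto
  then have XZ: "trans_num X = 1 - trans_num Z"
    using trans_num_add_int[OF Z, of "-1"] by (simp add: N_def)
  have Vgt: "x < V x" for x
  proof (rule ccontr)
    assume "\<not> x < V x"
    then have "V x \<le> x" "V (V x) \<le> V x" "V (V (V x)) \<le> V (V x)" by (simp_all add: deg1_le_iff[OF V(1)])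
    then show False using V(2)[of x] by simp
  qed
  have "\<exists>x. V x \<le> U x"
  proof (rule ccontr)
    assume "\<nexists>x. V x \<le> U x"
    then have *: "U x < V x" for x by (simp add: not_le)
    have "0 + 1 < V (U 0)" using *[of "U 0"] U(2)[of 0] by simp
    also have "\<dots> < V (V 0)" using * by (simp add: deg1_less_iff[OF V(1)])
    also have "\<dots> < V (V (V 0))" using Vgt by (simp add: deg1_less_iff[OF V(1)])
    finally show False using V(2)[of 0] by simp
  qed
  then obtain x where "V x \<le> U x" by blast
  then have "V (V (V x)) \<le> V (V (U x))" by (simp add: deg1_le_iff[OF V(1)])
  then have "x \<le> Z x" using V(2)[of x] by (simp add: Z_def)
  then have "0 \<le> trans_num Z" by (rule trans_num_ge_0[OF Z])
  then show "trans_num (U \<circ> V) \<le> 1" using XZ by (simp add: X_def)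
  have "trans_num Z < 1 / 3"
  proof (cases "\<exists>x. U x \<le> V x")
    case True
    then obtain x where "U x \<le> V x" by blast
    then have "V (V (U x)) \<le> V (V (V x))" by (simp add: deg1_le_iff[OF V(1)])
    then have "Z x \<le> x" using V(2)[of x] by (simp add: Z_def)
    then have "trans_num Z \<le> 0" by (rule trans_num_le_0[OF Z])
    then show ?thesis by simp
  next
    case False
    then have VU: "V x < U x" for x by (simp add: not_le)
    have ZV: "Z x < V x" for x
    proof -
      have "V (V (U x)) < V (U (U x))" using VU by (simp add: deg1_less_iff[OF V(1)])
      then show ?thesis using deg1_one[OF V(1), of x] by (simp add: Z_def U(2))
    qed
    have "(Z ^^ 3) x < x + 1" for x
    proof -
      have "Z (Z (Z x)) < V (Z (Z x))" by (rule ZV)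
      also have "\<dots> < V (V (Z x))" using ZV by (simp add: deg1_less_iff[OF V(1)])
      also have "\<dots> < V (V (V x))" using ZV by (simp add: deg1_less_iff[OF V(1)])
      finally show ?thesis using V(2)[of x] by (simp add: numeral_3_eq_3)
    qed
    then have "trans_num (Z ^^ 3) < 1" by (intro trans_num_less_1 deg1_funpow Z)
    then show ?thesis using trans_num_funpow[OF Z, of 3] by simp
  qed
  then show "2 / 3 < trans_num (U \<circ> V)" using XZ by (simp add: X_def)
qed

lemma rot_involution:
  assumes f: "f \<in> carrier homeo_circle_plus" and "f \<circ> f = id"
  shows "\<exists>t. rot f = to_circle t \<and> 2 * t \<in> \<int>"
proof -
  obtain F where F: "deg1 F" "f = circ F" using f by (auto simp: carrier_homeo_circle_plus)
  have "rot (f \<circ> f) = rot f + rot f" using rot_compose_commute f by blast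
  then have "to_circle (trans_num F + trans_num F) = 0"
    unfolding to_circle_add using assms(2) by (simp add: rot_id F rot_circ)
  then show ?thesis using F by (intro exI[of _ "trans_num F"]) (simp add: rot_circ to_circle_eq_0_iff)
qed

lemma rot_order_three:
  assumes f: "f \<in> carrier homeo_circle_plus" and "f \<circ> f \<circ> f = id"
  shows "\<exists>t. rot f = to_circle t \<and> 3 * t \<in> \<int>"
proof -
  obtain F where F: "deg1 F" "f = circ F" using f by (auto simp: carrier_homeo_circle_plus)
  have "f \<circ> f \<in> carrier homeo_circle_plus"
    using monoid.m_closed[OF group.is_monoid[OF group_homeo_circle_plus] f f] by simp
  then have "rot (f \<circ> f \<circ> f) = rot f + rot f + rot f"
    using rot_compose_commute[of f f] rot_compose_commute[of "f \<circ> f" f] f by (simp add: comp_assoc)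
  then have "to_circle (trans_num F + trans_num F + trans_num F) = 0"
    unfolding to_circle_add using assms(2) by (simp add: rot_id F rot_circ)
  moreover have "trans_num F + trans_num F + trans_num F = 3 * trans_num F" by simp
  ultimately show ?thesis using F by (intro exI[of _ "trans_num F"]) (simp add: rot_circ to_circle_eq_0_iff)
qed

text \<open>Lifts can be normalized so that \<open>U\<close> squares to the translation by 1, using
  that \<open>f\<close> is not the identity, and \<open>V\<close> cubes to the translation by 0, 1
  or -1. The value 0 forces \<open>g = id\<close> and is the only source of the clause
  \<open>2 * t \<in> \<int>\<close>; the value 1 is \<open>trans_num_modular\<close>, and -1 reduces
  to it by taking inverses.\<close>

lemma rot_modular:
  assumes f: "f \<in> carrier homeo_circle_plus" "f \<circ> f = id" "f \<noteq> id"
    and g: "g \<in> carrier homeo_circle_plus" "g \<circ> g \<circ> g = id"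
  shows "\<exists>t. rot (f \<circ> g) = to_circle t \<and> (\<bar>t\<bar> < 1 / 3 \<or> 2 * t \<in> \<int>)"
proof -
  obtain F where F: "deg1 F" "f = circ F" using f by (auto simp: carrier_homeo_circle_plus)
  obtain G where G: "deg1 G" "g = circ G" using g by (auto simp: carrier_homeo_circle_plus)
  have "circ (F \<circ> F) = circ (\<lambda>x. x)"
    using f(2) F circ_compose[of F F] by (simp add: circ_id)
  then obtain k where k: "\<And>x. F (F x) = x + of_int k"
    using circ_eq_iff[OF deg1_compose[OF F(1) F(1)] deg1_id(1)] by auto
  have "circ (G \<circ> G \<circ> G) = circ (\<lambda>x. x)"
    using g(2) G circ_compose[of G G] circ_compose[of "G \<circ> G" G] deg1_compose[of G G] by (simp add: circ_id)
  then obtain l where l: "\<And>x. G (G (G x)) = x + of_int l"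
    using circ_eq_iff[OF deg1_compose[OF deg1_compose[OF G(1) G(1)] G(1)] deg1_id(1)] by auto
  define U where "U = (\<lambda>x. F x + of_int (- (k div 2)))"
  have U: "deg1 U" "circ U = f" unfolding U_def
    by (rule deg1_shift[OF F(1)], unfold F(2), rule circ_add_int[OF F(1)])
  have UU: "U (U x) = x + of_int (k mod 2)" for x
  proof -
    have "k = 2 * (k div 2) + k mod 2" by simp
    then have "real_of_int k = 2 * of_int (k div 2) + of_int (k mod 2)" by (metis of_int_add of_int_mult of_int_numeral)
    then show ?thesis unfolding U_def deg1_add_int[OF F(1)] k by simp
  qed
  have "k mod 2 \<noteq> 0"
  proof
    assume "k mod 2 = 0"
    then have "U = (\<lambda>x. x)" using deg1_square_id[OF U(1)] UU by auto
    then show False using U(2) f(3) circ_id by simp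
  qed
  then have U2: "U (U x) = x + 1" for x using UU[of x] by (metis not_mod_2_eq_0_eq_1 of_int_1)
  define V where "V m = (\<lambda>x. G x + of_int m)" for m :: int
  have V: "deg1 (V m)" "circ (V m) = g" for m unfolding V_def
    by (rule deg1_shift[OF G(1)], unfold G(2), rule circ_add_int[OF G(1)])
  have VVV: "V m (V m (V m x)) = x + of_int (l + 3 * m)" for m x
    unfolding V_def deg1_add_int[OF G(1)] l by simp
  have rotV: "rot (f \<circ> g) = to_circle (trans_num (U \<circ> V m))" for m
    using rot_circ[OF deg1_compose[OF U(1) V(1)[of m]]] circ_compose[OF U(1) V(1)[of m]] U(2) V(2) by simp
  consider "\<exists>m. l + 3 * m = 0" | "\<exists>m. l + 3 * m = 1" | "\<exists>m. l + 3 * m = - 1"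
  proof -
    have "(\<exists>m. l + 3 * m = 0) \<or> (\<exists>m. l + 3 * m = 1) \<or> (\<exists>m. l + 3 * m = - 1)" by presburger
    then show ?thesis using that by blast
  qed
  then show ?thesis
  proof cases
    case 1
    then obtain m where m: "l + 3 * m = 0" by blast
    then have "V m x = x" for x using deg1_cube_id[OF V(1)] VVV[of m] by simp
    then have "g = id" using V(2)[of m] circ_id by (metis ext)
    then show ?thesis using rot_involution[OF f(1,2)] by auto
  next
    case 2
    then obtain m where m: "l + 3 * m = 1" by blast
    have "2 / 3 < trans_num (U \<circ> V m)" "trans_num (U \<circ> V m) \<le> 1"
      using trans_num_modular[OF U(1) U2 V(1)[of m]] VVV[of m] m by auto
    then show ?thesis using rotV[of m] to_circle_add_int[of "trans_num (U \<circ> V m)" "-1"]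
      by (intro exI[of _ "trans_num (U \<circ> V m) + of_int (-1)"]) auto
  next
    case 3
    then obtain m where m: "l + 3 * m = - 1" by blast
    define W where "W = V m"
    \<comment> \<open>A lift of the inverse of \<open>g\<close>, whose cube is the translation by 1.
      Below, \<open>B\<close> is the inverse of \<open>A\<close>, and \<open>W \<circ> U\<close> is
      conjugate to \<open>U \<circ> W\<close>.\<close>
    define W' where "W' = (\<lambda>x. W (W x) + of_int 1)"
    have W: "deg1 W" "\<And>x. W (W (W x)) = x - 1" using V(1) VVV[of m] m by (auto simp: W_def)
    have W': "deg1 W'" unfolding W'_def using deg1_shift[OF deg1_compose[OF W(1) W(1)], of "of_int 1"]
      by (simp add: comp_def)
    note one = deg1_one[OF W(1)] deg1_one[OF U(1)] deg1_add_int[OF W(1), of _ "-1"] deg1_add_int[OF U(1), of _ "-1"]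
    have two: "W (2 + y) = W y + 2" for y
      using deg1_add_int[OF W(1), of y 2] by (simp add: add.commute)
    have W'3: "W' (W' (W' x)) = x + 1" for x using one two W(2) by (simp add: W'_def)
    define A where "A = U \<circ> W'"
    define B where "B = (\<lambda>x. (W \<circ> U) x + of_int (-1))"
    have A: "deg1 A" and WU: "deg1 (W \<circ> U)" unfolding A_def by (intro deg1_compose U W W')+
    then have B: "deg1 B" unfolding B_def by (intro deg1_shift)
    have "A (B x) = x" "B (A x) = x" for x
      using one two W(2) U2 by (simp_all add: A_def B_def W'_def)
    then have "trans_num B = - trans_num A" by (intro trans_num_inverse A B)
    then have "trans_num (W \<circ> U) = 1 - trans_num A"
      using trans_num_add_int[OF WU, of "-1"] by (simp add: B_def)
    moreover have "2 / 3 < trans_num A" "trans_num A \<le> 1"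
      using trans_num_modular[OF U(1) U2 W' W'3] by (auto simp: A_def)
    ultimately have "\<bar>trans_num (U \<circ> V m)\<bar> < 1 / 3"
      using trans_num_compose_swap[OF U(1) W(1)] by (simp add: W_def)
    then show ?thesis using rotV by blast
  qed
qed

text \<open>For \<open>y\<close> in [0, 1/2], the first multiple that reaches 1/3 cannot jump over
  the middle third [1/3, 2/3], where only 1/2 is permitted. If it equals 1/2 while the multiple
  before it is below 1/3, then \<open>y\<close> exceeds 1/6, so it is the first or second multiple
  and \<open>4 * y\<close> is an integer. Otherwise no multiple up to \<open>n\<close> reaches
  1/3.\<close>

lemma multiples_avoiding_middle_third:
  fixes y :: real and n :: nat
  assumes n: "n \<ge> 3"
    and S: "\<And>j. j \<in> {1..n} \<Longrightarrow> \<exists>t. to_circle (real j * y) = to_circle t \<and> (\<bar>t\<bar> < 1 / 3 \<or> 2 * t \<in> \<int>)"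
  shows "\<exists>y'. to_circle y = to_circle y' \<and> (\<bar>y'\<bar> < 1 / (3 * n) \<or> 4 * y' \<in> \<int>)"
proof -
  have pos: "\<bar>z\<bar> < 1 / (3 * n) \<or> 4 * z \<in> \<int>"
    if z: "0 \<le> z" "z \<le> 1 / 2"
      and S: "\<And>j. j \<in> {1..n} \<Longrightarrow> \<exists>t. to_circle (real j * z) = to_circle t \<and> (\<bar>t\<bar> < 1 / 3 \<or> 2 * t \<in> \<int>)"
    for z
  proof -
    have mid: "real j * z = 1 / 2" if j: "j \<in> {1..n}" "1 / 3 \<le> real j * z" "real j * z \<le> 2 / 3" for j
    proof -
      obtain t where t: "to_circle (real j * z) = to_circle t" "\<bar>t\<bar> < 1 / 3 \<or> 2 * t \<in> \<int>"
        using S[OF j(1)] by blast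
      from t(1) obtain k where k: "real j * z = t + of_int k" by (rule to_circle_eqE)
      have "\<not> \<bar>t\<bar> < 1 / 3"
      proof
        assume "\<bar>t\<bar> < 1 / 3"
        then have "0 < real_of_int k" "real_of_int k < 1" using k j by linarith+
        then show False by simp
      qed
      then have "2 * t \<in> \<int>" using t(2) by blast
      then have "2 * (real j * z) \<in> \<int>" unfolding k by (simp add: distrib_left)
      then obtain m where m: "2 * (real j * z) = of_int m" by (auto elim: Ints_cases)
      then have "0 < real_of_int m" "real_of_int m < 2" using j by linarith+
      then have "m = 1" by linarith
      then show ?thesis using m by simp
    qed
    show ?thesis
    proof (cases "real n * z < 1 / 3")
      case True
      then show ?thesis using z n by (simp add: field_simps)
    next
      case False
      define j where "j = (LEAST j. 1 / 3 \<le> real j * z)"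
      have j: "1 / 3 \<le> real j * z" "j \<le> n"
        unfolding j_def using False LeastI[of "\<lambda>j. 1 / 3 \<le> real j * z" n] Least_le[of "\<lambda>j. 1 / 3 \<le> real j * z" n]
        by auto
      then have j0: "j \<noteq> 0" by (intro notI) simp
      have "\<not> 1 / 3 \<le> real (j - 1) * z"
        unfolding j_def by (rule not_less_Least) (use j0 in \<open>simp add: j_def\<close>)
      then have less: "real j * z < 1 / 3 + z" using j0 by (simp add: of_nat_diff algebra_simps)
      have jz: "real j * z = 1 / 2"
      proof (cases "z < 1 / 3")
        case True
        then show ?thesis using mid[of j] j j0 less by simp
      next
        case F: False
        then have "j = 1" unfolding j_def by (intro Least_equality) (auto simp: Suc_le_eq intro!: Nat.gr0I)
        then show ?thesis using mid[of j] j j0 z by simp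
      qed
      have "j < 3"
      proof (rule ccontr)
        assume "\<not> j < 3"
        then have "3 * z \<le> real j * z" using z by (intro mult_right_mono) auto
        then have "z \<le> 1 / 6" using jz by simp
        then show False using jz less by simp
      qed
      then have "j = 1 \<or> j = 2" using j0 by auto
      then have "4 * z = 2 \<or> 4 * z = 1" using jz by auto
      then show ?thesis by (metis Ints_1 Ints_numeral)
    qed
  qed
  define y0 where "y0 = y - of_int (round y)"
  have y0: "to_circle y = to_circle y0" "\<bar>y0\<bar> \<le> 1 / 2"
    using of_int_round_abs_le[of y] by (auto simp: y0_def to_circle_eq_iff abs_minus_commute)
  have eq: "to_circle (real j * y) = to_circle (real j * y0)" for j
    by (simp add: to_circle_eq_iff y0_def right_diff_distrib)
  have "\<bar>\<bar>y0\<bar>\<bar> < 1 / (3 * n) \<or> 4 * \<bar>y0\<bar> \<in> \<int>"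
  proof (rule pos)
    fix j assume "j \<in> {1..n}"
    then obtain t where t: "to_circle (real j * y0) = to_circle t" "\<bar>t\<bar> < 1 / 3 \<or> 2 * t \<in> \<int>"
      using S eq by metis
    show "\<exists>t. to_circle (real j * \<bar>y0\<bar>) = to_circle t \<and> (\<bar>t\<bar> < 1 / 3 \<or> 2 * t \<in> \<int>)"
    proof (cases "y0 \<ge> 0")
      case True
      then show ?thesis using t by auto
    next
      case False
      then show ?thesis using t to_circle_minus[of "real j * y0"] to_circle_minus[of t]
        by (intro exI[of _ "- t"]) auto
    qed
  qed (use y0 in auto)
  moreover have "4 * y0 \<in> \<int>" if "4 * \<bar>y0\<bar> \<in> \<int>" using that minus_in_Ints_iff[of "4 * y0"] by (auto simp: abs_if split: if_splits)
  ultimately show ?thesis using y0(1) by auto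
qed

text \<open>The line is the universal cover of the projective line, a point \<open>y\<close> lying over the direction
  \<open>(cos (\<pi>y), sin (\<pi>y))\<close>.  Here \<open>U\<close> lifts the matrix with rows \<open>(0, -1/b)\<close>, \<open>(b, 0)\<close>, and \<open>b\<close> is chosen
  such that following the rotation by \<open>-s\<close> with \<open>U\<close> gives a matrix of trace \<open>1\<close> and determinant \<open>1\<close>,
  whose cube is \<open>-1\<close>.\<close>

lemma modular_involution:
  assumes s: "0 < s" "s \<le> 1 / 6"
  shows "\<exists>U. deg1 U \<and> (\<forall>x. U (U x) = x + 1) \<and> (\<forall>x. \<exists>k::int. U (U (U (x - s) - s) - s) = x + of_int k)"
proof -
  define \<sigma> where "\<sigma> = sin (pi * s)"
  have \<sigma>: "0 < \<sigma>" "\<sigma> \<le> 1 / 2"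
  proof -
    show "0 < \<sigma>" unfolding \<sigma>_def using s by (intro sin_gt_zero) auto
    have "0 < pi * s" "pi * s \<le> pi / 6" using s by simp_all
    then have "sin (pi * s) \<le> sin (pi / 6)" by (intro sin_monotone_2pi_le) linarith+
    then show "\<sigma> \<le> 1 / 2" by (simp add: \<sigma>_def sin_30)
  qed
  \<comment> \<open>The larger root of \<sigma> b^2 - b + \<sigma> = 0, which is the trace condition
    \<sigma> (b + 1/b) = 1. It is real because \<sigma> is at most 1/2; this is where the bound 1/6
    on \<open>s\<close> comes from.\<close>
  define b where "b = (1 + sqrt (1 - 4 * \<sigma>\<^sup>2)) / (2 * \<sigma>)"
  have "4 * \<sigma>\<^sup>2 \<le> 1" using \<sigma> power_mono[of \<sigma> "1/2" 2] by (simp add: power2_eq_square)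
  then have b: "b > 0" "(1 / b + b) * \<sigma> = 1"
  proof -
    have "sqrt (1 - 4 * \<sigma>\<^sup>2) \<ge> 0" using \<open>4 * \<sigma>\<^sup>2 \<le> 1\<close> by simp
    then show b0: "b > 0" unfolding b_def using \<sigma>(1) by (intro divide_pos_pos add_pos_nonneg) simp_all
    have "2 * \<sigma> * b - 1 = sqrt (1 - 4 * \<sigma>\<^sup>2)" unfolding b_def using \<sigma>(1) by simp
    then have "(2 * \<sigma> * b - 1)\<^sup>2 = 1 - 4 * \<sigma>\<^sup>2" using \<open>4 * \<sigma>\<^sup>2 \<le> 1\<close> real_sqrt_pow2 by simp
    moreover have "4 * \<sigma> * (\<sigma> * b\<^sup>2 - b + \<sigma>) = (2 * \<sigma> * b - 1)\<^sup>2 - (1 - 4 * \<sigma>\<^sup>2)"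
      by (simp add: power2_eq_square algebra_simps)
    ultimately have "\<sigma> * b\<^sup>2 - b + \<sigma> = 0"
      using \<sigma>(1) by (metis eq_iff_diff_eq_0 less_irrefl mult_eq_0_iff zero_neq_numeral)
    then have *: "\<sigma> + \<sigma> * b\<^sup>2 = b" by linarith
    have "(1 / b + b) * \<sigma> = (\<sigma> + \<sigma> * b\<^sup>2) / b"
      using b0 by (simp add: add_divide_distrib power2_eq_square distrib_right)
    then show "(1 / b + b) * \<sigma> = 1" unfolding * using b0 by simp
  qed
  \<comment> \<open>With C and S the cosine and sine of \<pi>y, the matrix sends (C, S) to (-S/b,
    bC), which is (bC, S/b) turned by a right angle. \<open>h\<close> is the tangent of the angle
    from (C, S) to (bC, S/b): cross product over dot product. The dot product is positive, so
    \<open>arctan\<close> chooses this angle continuously.\<close>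
  define h where "h y = sin (pi * y) * cos (pi * y) * (1 / b - b) / ((sin (pi * y))\<^sup>2 / b + b * (cos (pi * y))\<^sup>2)" for y
  define U where "U y = y + 1 / 2 + arctan (h y) / pi" for y
  have den: "(sin (pi * y))\<^sup>2 / b + b * (cos (pi * y))\<^sup>2 > 0" for y
  proof (cases "sin (pi * y) = 0")
    case True
    then have "(cos (pi * y))\<^sup>2 = 1" using sin_cos_squared_add[of "pi * y"] by simp
    then show ?thesis using True b by simp
  next
    case False
    then show ?thesis using b by (intro add_pos_nonneg) auto
  qed
  have cont: "continuous_on UNIV U"
    unfolding U_def h_def using den b by (intro continuous_intros) (auto simp: less_imp_neq[symmetric])
  have one: "U (y + 1) = U y + 1" for y
  proof -
    have "sin (pi * (y + 1)) = - sin (pi * y)" "cos (pi * (y + 1)) = - cos (pi * y)"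
      by (simp_all add: distrib_left)
    then have "h (y + 1) = h y" unfolding h_def by simp
    then show ?thesis by (simp add: U_def)
  qed
  have dir: "\<exists>\<rho>>0. cos (pi * U y) = \<rho> * (- sin (pi * y) / b) \<and> sin (pi * U y) = \<rho> * (b * cos (pi * y))" for y
  proof -
    define S C d where "S = sin (pi * y)" and "C = cos (pi * y)" and "d = S\<^sup>2 / b + b * C\<^sup>2"
    have SC: "S\<^sup>2 + C\<^sup>2 = 1" by (simp add: S_def C_def)
    have d: "d > 0" using den[of y] by (simp add: d_def S_def C_def)
    define w where "w = sqrt (1 + (h y)\<^sup>2)"
    have w: "w > 0" unfolding w_def by (intro real_sqrt_gt_zero add_pos_nonneg) auto
    have hd: "h y * d = S * C * (1 / b - b)" using d by (simp add: h_def S_def C_def d_def)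
    have "pi * U y = (pi * y + arctan (h y)) + pi / 2" by (simp add: U_def field_simps)
    then have "cos (pi * U y) = - sin (pi * y + arctan (h y))" "sin (pi * U y) = cos (pi * y + arctan (h y))"
      by (metis cos_add cos_pi_half mult_zero_right mult_1_right sin_pi_half diff_0,
          metis sin_add cos_pi_half mult_zero_right mult_1_right sin_pi_half add_0)
    then have "cos (pi * U y) = - (S + C * h y) / w" "sin (pi * U y) = (C - S * h y) / w"
      by (simp_all add: sin_add cos_add sin_arctan cos_arctan S_def C_def w_def field_simps add_divide_distrib diff_divide_distrib)
    moreover have "(S + C * h y) * d = S / b"
    proof -
      have "(S + C * h y) * d = S * d + C * (h y * d)" by (simp add: algebra_simps)
      also have "\<dots> = S * (S\<^sup>2 + C\<^sup>2) / b" unfolding hd unfolding d_def using b by (simp add: field_simps power2_eq_square)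
      finally show ?thesis by (simp add: SC)
    qed
    moreover have "(C - S * h y) * d = b * C"
    proof -
      have "(C - S * h y) * d = C * d - S * (h y * d)" by (simp add: algebra_simps)
      also have "\<dots> = b * C * (S\<^sup>2 + C\<^sup>2)" unfolding hd unfolding d_def using b by (simp add: field_simps power2_eq_square)
      finally show ?thesis by (simp add: SC)
    qed
    ultimately have *: "cos (pi * U y) = - (S + C * h y) / w" "sin (pi * U y) = (C - S * h y) / w"
      "S + C * h y = S / b / d" "C - S * h y = b * C / d"
      using d by (simp_all add: nonzero_eq_divide_eq del: divide_divide_eq_left)
    have "cos (pi * U y) = 1 / (w * d) * (- S / b)" "sin (pi * U y) = 1 / (w * d) * (b * C)"
      unfolding *(1,2) unfolding *(3,4) by (simp_all add: ac_simps)
    moreover have "1 / (w * d) > 0" using w d by simp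
    ultimately show ?thesis unfolding S_def C_def by blast
  qed
  have parallel: "\<exists>k::int. z = y + of_int k"
    if "cos (pi * z) = r * cos (pi * y)" "sin (pi * z) = r * sin (pi * y)" for y z r
  proof -
    have "sin (pi * z - pi * y) = 0" unfolding sin_diff that by simp
    then obtain k :: int where "pi * z - pi * y = of_int k * pi" using sin_zero_iff_int2 by blast
    then have "pi * z = pi * (y + of_int k)" by (simp add: algebra_simps)
    then show ?thesis by auto
  qed
  have UU: "U (U y) = y + 1" for y
  proof -
    obtain r1 where r1: "cos (pi * U y) = r1 * (- sin (pi * y) / b)" "sin (pi * U y) = r1 * (b * cos (pi * y))"
      using dir by blast
    obtain r2 where r2: "cos (pi * U (U y)) = r2 * (- sin (pi * U y) / b)" "sin (pi * U (U y)) = r2 * (b * cos (pi * U y))"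
      using dir by blast
    have "cos (pi * U (U y)) = - (r1 * r2) * cos (pi * y)" "sin (pi * U (U y)) = - (r1 * r2) * sin (pi * y)"
      unfolding r2 r1 using b by simp_all
    then obtain k :: int where k: "U (U y) = y + of_int k" using parallel by blast
    have "y < U y" "U y < y + 1" for y
      using arctan_lbound[of "h y"] arctan_ubound[of "h y"] by (simp_all add: U_def field_simps)
    then have "y < U (U y)" "U (U y) < y + 2" by (metis less_trans, smt (verit))
    then have "0 < real_of_int k" "real_of_int k < 2" using k by auto
    then have "k = 1" by linarith
    then show ?thesis using k by simp
  qed
  have "inj U" using UU by (metis add_right_cancel injI)
  have sm: "strict_mono U"
  proof (rule strict_monoI)
    fix x y :: real assume xy: "x < y"
    define l where "l = y - x + 1"
    define z where "z = x + real_of_int \<lceil>l\<rceil>"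
    have "y < z" using le_of_int_ceiling[of l] unfolding l_def z_def by linarith
    \<comment> \<open>A continuous injection of an interval is monotone. The comparison of
      \<open>x\<close> with its integer translate \<open>z\<close> beyond \<open>y\<close> then
      decides that \<open>U\<close> is increasing.\<close>
    then have mono: "U x < U y \<and> U y < U z \<or> U z < U y \<and> U y < U x"
      using xy continuous_on_subset[OF cont] inj_on_subset[OF \<open>inj U\<close>]
      by (intro continuous_inj_imp_mono[where f = U and a = x and x = y and b = z]) simp_all
    have nat: "U (x + real n) = U x + real n" for n
    proof (induction n)
      case (Suc n)
      then show ?case using one[of "x + real n"] by (simp add: algebra_simps)
    qed simp
    have "l > 0" using xy by (simp add: l_def)
    then have "U z = U x + real_of_int (\<lceil>l\<rceil>)" "0 < real_of_int \<lceil>l\<rceil>"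
      unfolding z_def using nat[of "nat \<lceil>l\<rceil>"] by simp_all
    then show "U x < U y" using mono by linarith
  qed
  have U: "deg1 U" using cont sm one by (simp add: deg1_def)
  define c where "c = cos (pi * s)"
  have \<sigma>c: "\<sigma>\<^sup>2 + c\<^sup>2 = 1" by (simp add: \<sigma>_def c_def)
  \<comment> \<open>\<open>M1\<close> and \<open>M2\<close> are the two rows of the matrix of
    \<open>U\<close> after the rotation by \<open>-s\<close>; its trace is \<sigma> (1/b + b) = 1
    and its determinant is \<sigma>^2 + c^2 = 1.\<close>
  define M1 where "M1 p q = \<sigma> / b * p - c / b * q" for p q :: real
  define M2 where "M2 p q = b * c * p + b * \<sigma> * q" for p q :: real
  have dirV: "\<exists>\<rho>. cos (pi * U (y - s)) = \<rho> * M1 (cos (pi * y)) (sin (pi * y)) \<and>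
      sin (pi * U (y - s)) = \<rho> * M2 (cos (pi * y)) (sin (pi * y))" for y
  proof -
    obtain r where r: "cos (pi * U (y - s)) = r * (- sin (pi * (y - s)) / b)" "sin (pi * U (y - s)) = r * (b * cos (pi * (y - s)))"
      using dir by blast
    have "- sin (pi * (y - s)) / b = M1 (cos (pi * y)) (sin (pi * y))"
      "b * cos (pi * (y - s)) = M2 (cos (pi * y)) (sin (pi * y))"
      unfolding M1_def M2_def using b
      by (simp_all add: right_diff_distrib sin_diff cos_diff \<sigma>_def c_def field_simps)
    then show ?thesis using r by auto
  qed
  have lin: "M1 (r * p) (r * q) = r * M1 p q" "M2 (r * p) (r * q) = r * M2 p q" for r p q
    by (simp_all add: M1_def M2_def algebra_simps)
  \<comment> \<open>Cayley-Hamilton for trace 1 and determinant 1: the square of the matrix is the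
    matrix minus the identity, and so its cube is minus the identity.\<close>
  have sq: "M1 (M1 p q) (M2 p q) = M1 p q - p" "M2 (M1 p q) (M2 p q) = M2 p q - q" for p q
  proof -
    have tr: "\<sigma> / b = 1 - b * \<sigma>" using b by (simp add: algebra_simps)
    have c2: "c * c = 1 - \<sigma> * \<sigma>" using \<sigma>c by (simp add: power2_eq_square)
    have det: "c / b * (b * c) = 1 - \<sigma> / b * (b * \<sigma>)" using b c2 by simp
    have "M1 (M1 p q) (M2 p q) = (\<sigma> / b * (\<sigma> / b) - c / b * (b * c)) * p - c / b * (\<sigma> / b + b * \<sigma>) * q"
      by (simp add: M1_def M2_def algebra_simps)
    also have "\<dots> = M1 p q - p" unfolding det tr by (simp add: M1_def tr algebra_simps)
    finally show "M1 (M1 p q) (M2 p q) = M1 p q - p" .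
    have "M2 (M1 p q) (M2 p q) = b * c * (\<sigma> / b + b * \<sigma>) * p + (b * \<sigma> * (b * \<sigma>) - c / b * (b * c)) * q"
      by (simp add: M1_def M2_def algebra_simps)
    also have "\<dots> = M2 p q - q" unfolding det tr by (simp add: M2_def algebra_simps)
    finally show "M2 (M1 p q) (M2 p q) = M2 p q - q" .
  qed
  have "\<exists>k::int. U (U (U (y - s) - s) - s) = y + of_int k" for y
  proof -
    define p q where "p = cos (pi * y)" and "q = sin (pi * y)"
    define y1 where "y1 = U (y - s)"
    define y2 where "y2 = U (y1 - s)"
    define y3 where "y3 = U (y2 - s)"
    obtain r1 where r1: "cos (pi * y1) = r1 * M1 p q" "sin (pi * y1) = r1 * M2 p q"
      using dirV unfolding y1_def p_def q_def by blast
    obtain r2 where r2: "cos (pi * y2) = r2 * (r1 * (M1 p q - p))" "sin (pi * y2) = r2 * (r1 * (M2 p q - q))"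
      using dirV[of y1] unfolding y2_def[symmetric] r1 lin sq by blast
    have add: "M1 (a - a') (e - e') = M1 a e - M1 a' e'" "M2 (a - a') (e - e') = M2 a e - M2 a' e'" for a e a' e'
      unfolding M1_def M2_def right_diff_distrib by linarith+
    obtain r3 where "cos (pi * y3) = r3 * (r2 * (r1 * (M1 p q - p - M1 p q)))" "sin (pi * y3) = r3 * (r2 * (r1 * (M2 p q - q - M2 p q)))"
      using dirV[of y2] unfolding y3_def[symmetric] r2 lin add sq by blast
    then have "cos (pi * y3) = - (r1 * r2 * r3) * p" "sin (pi * y3) = - (r1 * r2 * r3) * q" by simp_all
    then show ?thesis using parallel unfolding p_def q_def y3_def y2_def y1_def by blast
  qed
  then show ?thesis using U UU by blast
qed

text \<open>For nonzero \<open>s\<close>, take the involution \<open>u\<close> that belongs to the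
  absolute value of \<open>s\<close>, and let \<open>v\<close> be \<open>u\<close> after the
  rotation by \<open>s\<close>; then \<open>u \<circ> v\<close> is that rotation because
  \<open>u\<close> is an involution. The map \<open>d\<close> conjugates \<open>u\<close> to the
  half turn.\<close>

lemma rotation_modular:
  assumes s: "\<bar>s\<bar> \<le> 1 / 6"
  shows "\<exists>u\<in>carrier homeo_circle_plus. \<exists>v\<in>carrier homeo_circle_plus. \<exists>d\<in>carrier homeo_circle_plus.
    u \<circ> u = id \<and> v \<circ> v \<circ> v = id \<and> u \<circ> v = circ (\<lambda>x. x + s) \<and>
    d \<circ> u = circ (\<lambda>x. x + (if s = 0 then 0 else 1 / 2)) \<circ> d"
proof (cases "s = 0")
  case True
  have "id \<in> carrier homeo_circle_plus" using circ_in_carrier[OF deg1_id(1)] by (simp add: circ_id)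
  then show ?thesis using True by (intro bexI[of _ id]) (auto simp: circ_id)
next
  case False
  then obtain U where U: "deg1 U" "\<And>x. U (U x) = x + 1"
    and k: "\<And>x. \<exists>k::int. U (U (U (x - \<bar>s\<bar>) - \<bar>s\<bar>) - \<bar>s\<bar>) = x + of_int k"
    using modular_involution[of "\<bar>s\<bar>"] s by auto
  define u where "u = circ U"
  define r where "r t = circ (\<lambda>x. x + t)" for t
  have rr: "r a \<circ> r b = r (a + b)" for a b
    unfolding r_def using circ_compose[of "\<lambda>x. x + a" "\<lambda>x. x + b"] by (simp add: comp_def add_ac)
  have r0: "r 0 = id" by (simp add: r_def circ_id)
  have u: "u \<in> carrier homeo_circle_plus" and rc: "r t \<in> carrier homeo_circle_plus" for t
    unfolding u_def r_def by (auto intro: circ_in_carrier U)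
  have urc: "u \<circ> r t \<in> carrier homeo_circle_plus" for t
    using monoid.m_closed[OF group.is_monoid[OF group_homeo_circle_plus] u rc] by simp
  have uu: "u (u c) = c" for c
  proof -
    obtain x where x: "c = to_circle x" by (rule to_circle_cases)
    show ?thesis using to_circle_add_int[of x 1] by (simp add: u_def x circ_to_circle U)
  qed
  have rinv: "r t (r (-t) c) = c" "r (-t) (r t c) = c" for t c
    using rr[of t "-t"] rr[of "-t" t] r0 by (metis comp_apply id_apply add.right_inverse add.left_inverse)+
  have cube1: "u (r (-\<bar>s\<bar>) (u (r (-\<bar>s\<bar>) (u (r (-\<bar>s\<bar>) c))))) = c" for c
  proof -
    obtain x where x: "c = to_circle x" by (rule to_circle_cases)
    obtain k :: int where "U (U (U (x - \<bar>s\<bar>) - \<bar>s\<bar>) - \<bar>s\<bar>) = x + of_int k" using k by blast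
    then show ?thesis using to_circle_add_int[of x k]
      by (simp add: u_def r_def x circ_to_circle U)
  qed
  \<comment> \<open>The inverse of \<open>u \<circ> r (-t)\<close> is \<open>r t \<circ> u\<close>,
    a conjugate of \<open>u \<circ> r t\<close>, so the relation holds for both signs of the
    angle.\<close>
  have cube2: "u (r \<bar>s\<bar> (u (r \<bar>s\<bar> (u (r \<bar>s\<bar> c))))) = c" for c
  proof -
    define c' where "c' = u (r \<bar>s\<bar> (u (r \<bar>s\<bar> (u (r \<bar>s\<bar> c)))))"
    have "r \<bar>s\<bar> c = r \<bar>s\<bar> c'"
      using cube1[of "r \<bar>s\<bar> c'"] unfolding c'_def by (simp add: uu rinv)
    then show ?thesis using rinv(2) unfolding c'_def by metis
  qed
  have cube: "u (r s (u (r s (u (r s c))))) = c" for c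
    using cube1 cube2 by (cases "s \<ge> 0") auto
  \<comment> \<open>The average of the two elements of an orbit modulo translation: replacing
    \<open>x\<close> by \<open>U x\<close> replaces \<open>x + U x\<close> by
    \<open>U x + x + 1\<close>.\<close>
  define P where "P x = (x + U x) / 2" for x
  have "continuous_on UNIV P" unfolding P_def
    by (intro continuous_on_divide continuous_on_add continuous_on_id continuous_on_const deg1_cont U(1)) simp
  moreover have "strict_mono P"
    unfolding P_def strict_mono_def using deg1_less_iff[OF U(1)] by (simp add: add_strict_mono divide_strict_right_mono)
  moreover have "P (x + 1) = P x + 1" for x
    using deg1_one[OF U(1), of x] by (simp add: P_def field_simps)
  ultimately have P: "deg1 P" by (simp add: deg1_def)
  have PU: "P (U x) = P x + 1 / 2" for x by (simp add: P_def U add_divide_distrib)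
  have conj: "circ P \<circ> u = r (1 / 2) \<circ> circ P"
  proof
    fix c obtain x where x: "c = to_circle x" by (rule to_circle_cases)
    show "(circ P \<circ> u) c = (r (1 / 2) \<circ> circ P) c" by (simp add: x u_def r_def circ_to_circle U(1) P PU)
  qed
  have eqs: "u \<circ> u = id" "(u \<circ> r s) \<circ> (u \<circ> r s) \<circ> (u \<circ> r s) = id" "u \<circ> (u \<circ> r s) = r s"
    using cube uu by auto
  have "d \<circ> u = r (if s = 0 then 0 else 1 / 2) \<circ> d" if "d = circ P" for d using conj that False by simp
  then show ?thesis
    using u urc[of s] circ_in_carrier[OF P] eqs unfolding r_def by blast
qed

section \<open>Groups of tuples of circle homeomorphisms\<close>

lemma homeo_circle_plus_compose:
  "f \<in> carrier homeo_circle_plus \<Longrightarrow> g \<in> carrier homeo_circle_plus \<Longrightarrow> f \<circ> g \<in> carrier homeo_circle_plus"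
  using monoid.m_closed[OF group.is_monoid[OF group_homeo_circle_plus]] by simp

lemma homeo_circle_plus_id: "id \<in> carrier homeo_circle_plus"
  using monoid.one_closed[OF group.is_monoid[OF group_homeo_circle_plus]] by simp

section \<open>Symmetry and isomorphism invariance of the set of rotation numbers\<close>

lemma rot_XI: "\<rho> \<in> hom G homeo_circle_plus \<Longrightarrow> c = rot (\<rho> a) \<Longrightarrow> c \<in> rot_X G a"
  by (auto simp: rot_X_def)

text \<open>Conjugation by the reflection of the circle reverses orientation twice, so it turns an
  action into another one, and it negates rotation numbers.\<close>

lemma rot_X_uminus:
  assumes a: "a \<in> carrier G" and c: "c \<in> rot_X G a"
  shows "- c \<in> rot_X G a"
proof -
  obtain \<rho> where \<rho>: "\<rho> \<in> hom G homeo_circle_plus" "c = rot (\<rho> a)"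
    using c by (auto simp: rot_X_def)
  define \<nu> where "\<nu> f = uminus \<circ> f \<circ> uminus" for f :: "circle \<Rightarrow> circle"
  have circ: "\<nu> (circ F) = circ (\<lambda>x. - F (- x))" if F: "deg1 F" for F
  proof (rule circ_unique)
    show "deg1 (\<lambda>x. - F (- x))" by (rule trans_num_reflect[OF F])
    show "\<nu> (circ F) (to_circle x) = to_circle (- F (- x))" for x
      by (simp add: \<nu>_def to_circle_minus[symmetric] circ_to_circle[OF F])
  qed
  have "(\<lambda>g. \<nu> (\<rho> g)) \<in> hom G homeo_circle_plus"
  proof (rule homI)
    fix g assume "g \<in> carrier G"
    then have "\<rho> g \<in> carrier homeo_circle_plus" using \<rho> by (auto simp: hom_def)
    then show "\<nu> (\<rho> g) \<in> carrier homeo_circle_plus"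
      using circ circ_in_carrier trans_num_reflect(1) by (auto simp: carrier_homeo_circle_plus)
  next
    fix g h assume "g \<in> carrier G" "h \<in> carrier G"
    then have "\<rho> (g \<otimes>\<^bsub>G\<^esub> h) = \<rho> g \<circ> \<rho> h" using \<rho> by (auto simp: hom_def)
    then show "\<nu> (\<rho> (g \<otimes>\<^bsub>G\<^esub> h)) = \<nu> (\<rho> g) \<otimes>\<^bsub>homeo_circle_plus\<^esub> \<nu> (\<rho> h)"
      by (auto simp: \<nu>_def)
  qed
  moreover obtain F where F: "deg1 F" "\<rho> a = circ F"
    using hom_in_carrier[OF \<rho>(1) a] by (auto simp: carrier_homeo_circle_plus)
  then have "rot (\<nu> (\<rho> a)) = - c"
    using rot_circ trans_num_reflect[OF F(1)] circ[OF F(1)] \<rho>(2) by (simp add: to_circle_minus)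
  ultimately show ?thesis by (intro rot_XI[of "\<lambda>g. \<nu> (\<rho> g)"]) simp_all
qed

lemma zero_in_rot_X: "0 \<in> rot_X G a"
proof -
  have "(\<lambda>_. id) \<in> hom G homeo_circle_plus"
    using homeo_circle_plus_id by (auto simp: hom_def)
  then show ?thesis using rot_id by (intro rot_XI[of "\<lambda>_. id"]) simp_all
qed

lemma rot_X_hom_subset:
  assumes k: "k \<in> hom G N"
  shows "rot_X N (k a) \<subseteq> rot_X G a"
proof
  fix c assume "c \<in> rot_X N (k a)"
  then obtain \<rho> where \<rho>: "\<rho> \<in> hom N homeo_circle_plus" "c = rot (\<rho> (k a))" by (auto simp: rot_X_def)
  then have "\<rho> \<circ> k \<in> hom G homeo_circle_plus" using Group.hom_compose[OF k] by blast
  then show "c \<in> rot_X G a" using \<rho>(2) by (intro rot_XI[of "\<rho> \<circ> k"]) simp_all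
qed

lemma rot_X_iso:
  assumes G: "group G" and h: "h \<in> iso G N" and a: "a \<in> carrier G"
  shows "rot_X N (h a) = rot_X G a"
proof -
  have k: "inv_into (carrier G) h \<in> iso N G" by (rule group.iso_set_sym[OF G h])
  have "inv_into (carrier G) h (h a) = a"
    using h a by (auto simp: iso_def bij_betw_def inv_into_f_f)
  then show ?thesis
    using rot_X_hom_subset[of h G N a] rot_X_hom_subset[of "inv_into (carrier G) h" N G "h a"] h k
    by (auto simp: iso_def)
qed

text \<open>The realizing group will consist of tuples of circle maps; an enumeration of its
  elements transports its multiplication to natural numbers.\<close>

lemma countable_group_nat:
  assumes G: "group G" and count: "countable (carrier G)" and a: "a \<in> carrier G"
  shows "\<exists>(N :: nat monoid) b. group N \<and> countable (carrier N) \<and> b \<in> carrier N \<and> rot_X N b = rot_X G a"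
proof -
  define e where "e = to_nat_on (carrier G)"
  have inj: "inj_on e (carrier G)" unfolding e_def by (rule inj_on_to_nat_on[OF count])
  define N where "N = (\<lparr>carrier = e ` carrier G,
     monoid.mult = (\<lambda>x y. e (inv_into (carrier G) e x \<otimes>\<^bsub>G\<^esub> inv_into (carrier G) e y)), one = e \<one>\<^bsub>G\<^esub>\<rparr> :: nat monoid)"
  interpret G: group G by (rule G)
  have inve: "inv_into (carrier G) e (e x) = x" if "x \<in> carrier G" for x using inj that by simp
  have "group N"
  proof (rule groupI)
    fix x assume "x \<in> carrier N"
    then obtain y where "y \<in> carrier G" "x = e y" by (auto simp: N_def)
    then show "\<exists>z\<in>carrier N. z \<otimes>\<^bsub>N\<^esub> x = \<one>\<^bsub>N\<^esub>"
      by (auto simp: N_def inve intro!: bexI[of _ "m_inv G y"])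
  qed (auto simp: N_def inve G.m_assoc)
  moreover have "e \<in> iso G N"
    using inj by (auto simp: iso_def hom_def bij_betw_def N_def inve)
  moreover have "e a \<in> carrier N" using a by (auto simp: N_def)
  ultimately show ?thesis using rot_X_iso[OF G _ a] by (metis countableI_type)
qed

lemma (in group) countable_generate:
  assumes S: "S \<subseteq> carrier G" "countable S"
  shows "countable (generate G S)"
proof -
  define T where "T = S \<union> m_inv G ` S"
  define w where "w l = foldr (\<otimes>) l \<one>" for l
  have T: "T \<subseteq> carrier G" using S by (auto simp: T_def)
  have wc: "w l \<in> carrier G" if "l \<in> lists T" for l
    using that T by (induction l) (auto simp: w_def)
  have wapp: "w (l @ l') = w l \<otimes> w l'" if "l \<in> lists T" "l' \<in> lists T" for l l'
    using that(1)
  proof (induction l)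
    case Nil
    then show ?case using wc[OF that(2)] by (simp add: w_def)
  next
    case (Cons x l)
    then show ?case using wc[OF that(2)] wc[of l] T by (auto simp: w_def m_assoc)
  qed
  have w1: "x = w [x]" if "x \<in> T" for x using that T by (auto simp: w_def)
  have "g \<in> w ` lists T" if "g \<in> generate G S" for g
    using that
  proof induction
    case one
    show ?case by (rule image_eqI[of _ _ "[]"]) (auto simp: w_def)
  next
    case (incl h)
    then show ?case using w1 by (intro image_eqI[of _ _ "[h]"]) (auto simp: T_def)
  next
    case (inv h)
    then show ?case using w1 by (intro image_eqI[of _ _ "[m_inv G h]"]) (auto simp: T_def)
  next
    case (eng h1 h2)
    then obtain l1 l2 where "h1 = w l1" "h2 = w l2" "l1 \<in> lists T" "l2 \<in> lists T" by blast
    then show ?case using wapp by (intro image_eqI[of _ _ "l1 @ l2"]) auto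
  qed
  then have "generate G S \<subseteq> w ` lists T" by blast
  moreover have "countable (w ` lists T)"
    using S(2) by (auto simp: T_def)
  ultimately show ?thesis by (rule countable_subset)
qed

text \<open>Coordinates are indexed by all reals; the tuples of angles considered later are extended
  by 0 outside their index set.\<close>

definition power_group :: "(real \<Rightarrow> circle \<Rightarrow> circle) monoid"
  where "power_group = \<lparr>carrier = {\<phi>. \<forall>r. \<phi> r \<in> carrier homeo_circle_plus},
    monoid.mult = (\<lambda>\<phi> \<psi> r. \<phi> r \<circ> \<psi> r), one = (\<lambda>_. id)\<rparr>"

lemma group_power_group: "group power_group"
proof (rule groupI)
  fix \<phi> assume \<phi>: "\<phi> \<in> carrier power_group"
  have "\<exists>g. g \<in> carrier homeo_circle_plus \<and> g \<circ> \<phi> r = id" for r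
    using group.l_inv_ex[OF group_homeo_circle_plus, of "\<phi> r"] \<phi> by (auto simp: power_group_def)
  then obtain \<psi> where "\<And>r. \<psi> r \<in> carrier homeo_circle_plus \<and> \<psi> r \<circ> \<phi> r = id" by metis
  then show "\<exists>\<psi>\<in>carrier power_group. \<psi> \<otimes>\<^bsub>power_group\<^esub> \<phi> = \<one>\<^bsub>power_group\<^esub>"
    by (intro bexI[of _ \<psi>]) (auto simp: power_group_def)
qed (auto simp: power_group_def homeo_circle_plus_compose homeo_circle_plus_id comp_assoc)

definition rotations :: "(real \<Rightarrow> real) \<Rightarrow> real \<Rightarrow> circle \<Rightarrow> circle"
  where "rotations f = (\<lambda>r. circ (\<lambda>x. x + f r))"

lemma rotations_in_power_group: "rotations f \<in> carrier power_group"
  by (auto simp: rotations_def power_group_def intro: circ_in_carrier)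

lemma rotations_add:
  "rotations f \<otimes>\<^bsub>power_group\<^esub> rotations g = rotations (\<lambda>r. f r + g r)"
proof
  fix r
  have "circ (\<lambda>x. x + f r) \<circ> circ (\<lambda>x. x + g r) = circ ((\<lambda>x. x + f r) \<circ> (\<lambda>x. x + g r))"
    by (rule circ_compose) simp_all
  then show "(rotations f \<otimes>\<^bsub>power_group\<^esub> rotations g) r = rotations (\<lambda>r. f r + g r) r"
    by (simp add: rotations_def power_group_def comp_def add_ac)
qed

lemma rotations_Ints:
  assumes "\<And>r. f r \<in> \<int>"
  shows "rotations f = \<one>\<^bsub>power_group\<^esub>"
proof
  fix r
  obtain k where "f r = of_int k" using assms[of r] by (auto elim: Ints_cases)
  then show "rotations f r = \<one>\<^bsub>power_group\<^esub> r"
    using circ_add_int[OF deg1_id(1), of k] by (simp add: rotations_def power_group_def circ_id)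
qed

section \<open>Rotation numbers of tuples of rotations in an arbitrary action\<close>

locale rotation_action =
  fixes S :: "(real \<Rightarrow> circle \<Rightarrow> circle) set" and \<rho> :: "(real \<Rightarrow> circle \<Rightarrow> circle) \<Rightarrow> circle \<Rightarrow> circle"
  assumes S: "S \<subseteq> carrier power_group"
    and \<rho>: "\<rho> \<in> hom (power_group\<lparr>carrier := generate power_group S\<rparr>) homeo_circle_plus"
begin

abbreviation "\<Gamma> \<equiv> generate power_group S"

lemma \<rho>_carrier: "x \<in> \<Gamma> \<Longrightarrow> \<rho> x \<in> carrier homeo_circle_plus"
  using hom_in_carrier[OF \<rho>] by simp

lemma \<rho>_mult: "x \<in> \<Gamma> \<Longrightarrow> y \<in> \<Gamma> \<Longrightarrow> \<rho> (x \<otimes>\<^bsub>power_group\<^esub> y) = \<rho> x \<circ> \<rho> y"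
  using hom_mult[OF \<rho>, of x y] by simp

lemma \<rho>_one: "\<rho> \<one>\<^bsub>power_group\<^esub> = id"
proof -
  have "group (power_group\<lparr>carrier := generate power_group S\<rparr>)"
    by (rule group.subgroup_imp_group[OF group_power_group group.generate_is_subgroup[OF group_power_group S]])
  then show ?thesis using hom_one[OF \<rho> _ group_homeo_circle_plus] by simp
qed

lemma \<rho>_inverse:
  assumes "x \<in> \<Gamma>"
  shows "\<exists>e. e \<circ> \<rho> x = id \<and> \<rho> x \<circ> e = id"
proof -
  obtain F where F: "deg1 F" "\<rho> x = circ F"
    using \<rho>_carrier[OF assms] by (auto simp: carrier_homeo_circle_plus)
  obtain G where G: "deg1 G" "\<And>x. F (G x) = x" "\<And>x. G (F x) = x" using deg1_inverse[OF F(1)] by metis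
  have "circ G \<circ> circ F = id" "circ F \<circ> circ G = id"
    using circ_inverse[OF G(1) F(1)] circ_inverse[OF F(1) G(1)] G by auto
  then show ?thesis using F(2) by auto
qed

text \<open>Tuples of rotations commute, so on those in \<Gamma> this is a homomorphism from tuples
  of angles to the circle that kills integer tuples. Nothing else relates it to the
  coordinates.\<close>

definition "\<theta> f = rot (\<rho> (rotations f))"

lemma rotations_add_closed:
  assumes "rotations f \<in> \<Gamma>" "rotations g \<in> \<Gamma>"
  shows "rotations (\<lambda>r. f r + g r) \<in> \<Gamma>"
  using generate.eng[OF assms] by (simp add: rotations_add)

lemma \<theta>_add:
  assumes "rotations f \<in> \<Gamma>" "rotations g \<in> \<Gamma>"
  shows "\<theta> (\<lambda>r. f r + g r) = \<theta> f + \<theta> g"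
proof -
  have "\<rho> (rotations f) \<circ> \<rho> (rotations g) = \<rho> (rotations g) \<circ> \<rho> (rotations f)"
    using \<rho>_mult[OF assms] \<rho>_mult[OF assms(2,1)] by (simp add: rotations_add add.commute)
  then show ?thesis
    using rot_compose_commute[OF \<rho>_carrier[OF assms(1)] \<rho>_carrier[OF assms(2)]] \<rho>_mult[OF assms]
    by (simp add: rotations_add \<theta>_def)
qed

lemma \<theta>_Ints:
  assumes "\<And>r. f r \<in> \<int>"
  shows "rotations f \<in> \<Gamma>" "\<theta> f = 0"
  using generate.one[of power_group S] by (simp_all add: rotations_Ints[OF assms] \<theta>_def \<rho>_one rot_id)

lemma \<theta>_scale:
  assumes "rotations f \<in> \<Gamma>" "\<theta> f = to_circle y"
  shows "rotations (\<lambda>r. real n * f r) \<in> \<Gamma> \<and> \<theta> (\<lambda>r. real n * f r) = to_circle (real n * y)"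
proof (induction n)
  case 0
  then show ?case using \<theta>_Ints[of "\<lambda>_. 0"] by (simp add: to_circle_0)
next
  case (Suc n)
  have eq: "(\<lambda>r. real (Suc n) * f r) = (\<lambda>r. f r + real n * f r)"
    "real (Suc n) * y = y + real n * y" by (auto simp: algebra_simps)
  show ?case unfolding eq
    using Suc assms rotations_add_closed \<theta>_add by (simp add: to_circle_add)
qed

text \<open>The element \<open>h\<close> is conjugate to every \<open>u\<close> at once, so either
  all of them act trivially or none does. In the first case the tuple \<open>g / 12\<close> acts
  with order dividing three and its twelfth multiple has rotation number 0. In the second,
  \<open>rot_modular\<close> applies to the first \<open>n\<close> multiples of the rotation number
  \<open>y\<close> of \<open>g / 12\<close>, so a representative of \<open>y\<close> is below 1/(3n)
  or a multiple of 1/4; multiplication by 12 gives 4/n, or 0.\<close>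

lemma \<theta>_small:
  assumes n: "n \<ge> 3" and h: "h \<in> \<Gamma>"
    and tool: "\<And>j. j \<in> {1..n} \<Longrightarrow> \<exists>u\<in>\<Gamma>. \<exists>v\<in>\<Gamma>. \<exists>d\<in>\<Gamma>.
      u \<otimes>\<^bsub>power_group\<^esub> u = \<one>\<^bsub>power_group\<^esub> \<and>
      v \<otimes>\<^bsub>power_group\<^esub> v \<otimes>\<^bsub>power_group\<^esub> v = \<one>\<^bsub>power_group\<^esub> \<and>
      u \<otimes>\<^bsub>power_group\<^esub> v = rotations (\<lambda>r. real j / 12 * g r) \<and>
      d \<otimes>\<^bsub>power_group\<^esub> u = h \<otimes>\<^bsub>power_group\<^esub> d"
  shows "rotations g \<in> \<Gamma> \<and> (\<exists>z. \<theta> g = to_circle z \<and> \<bar>z\<bar> < 4 / n)"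
proof -
  define g1 where "g1 = (\<lambda>r. g r / 12)"
  have gj: "(\<lambda>r. real j / 12 * g r) = (\<lambda>r. real j * g1 r)" for j by (auto simp: g1_def)
  have tool': "\<exists>u v. u \<in> carrier homeo_circle_plus \<and> v \<in> carrier homeo_circle_plus \<and>
      u \<circ> u = id \<and> v \<circ> v \<circ> v = id \<and> rotations (\<lambda>r. real j * g1 r) \<in> \<Gamma> \<and>
      \<rho> (rotations (\<lambda>r. real j * g1 r)) = u \<circ> v \<and> (u = id \<longleftrightarrow> \<rho> h = id)"
    if j: "j \<in> {1..n}" for j
  proof -
    obtain u v d where uvd: "u \<in> \<Gamma>" "v \<in> \<Gamma>" "d \<in> \<Gamma>"
      "u \<otimes>\<^bsub>power_group\<^esub> u = \<one>\<^bsub>power_group\<^esub>"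
      "v \<otimes>\<^bsub>power_group\<^esub> v \<otimes>\<^bsub>power_group\<^esub> v = \<one>\<^bsub>power_group\<^esub>"
      "u \<otimes>\<^bsub>power_group\<^esub> v = rotations (\<lambda>r. real j * g1 r)"
      "d \<otimes>\<^bsub>power_group\<^esub> u = h \<otimes>\<^bsub>power_group\<^esub> d"
      using tool[OF j] unfolding gj by blast
    have vv: "v \<otimes>\<^bsub>power_group\<^esub> v \<in> \<Gamma>" and uv: "u \<otimes>\<^bsub>power_group\<^esub> v \<in> \<Gamma>" by (rule generate.eng[OF uvd(2,2)], rule generate.eng[OF uvd(1,2)])
    have rel: "\<rho> u \<circ> \<rho> u = id" "\<rho> v \<circ> \<rho> v \<circ> \<rho> v = id"
      "\<rho> (rotations (\<lambda>r. real j * g1 r)) = \<rho> u \<circ> \<rho> v" "\<rho> d \<circ> \<rho> u = \<rho> h \<circ> \<rho> d"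
      using \<rho>_mult[OF uvd(1,1)] \<rho>_mult[OF uvd(2,2)] \<rho>_mult[OF vv uvd(2)] \<rho>_mult[OF uvd(1,2)]
        \<rho>_mult[OF uvd(3,1)] \<rho>_mult[OF h uvd(3)] uvd(4-7) \<rho>_one by simp_all
    obtain e where e: "e \<circ> \<rho> d = id" "\<rho> d \<circ> e = id" using \<rho>_inverse[OF uvd(3)] by blast
    have "\<rho> u = e \<circ> \<rho> h \<circ> \<rho> d" using rel(4) e by (metis comp_assoc id_comp)
    moreover have "\<rho> h = \<rho> d \<circ> \<rho> u \<circ> e" using rel(4) e by (metis comp_assoc comp_id)
    ultimately have "\<rho> u = id \<longleftrightarrow> \<rho> h = id" using e by auto
    then show ?thesis using rel uv uvd \<rho>_carrier by metis
  qed
  have g1: "rotations g1 \<in> \<Gamma>" using tool'[of 1] n by auto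
  obtain y where y: "\<theta> g1 = to_circle y" by (rule to_circle_cases)
  have g12: "(\<lambda>r. real 12 * g1 r) = g" by (auto simp: g1_def)
  have g: "rotations g \<in> \<Gamma>" "\<theta> g = to_circle (12 * y)"
    using \<theta>_scale[OF g1 y, of 12] unfolding g12 by auto
  have "\<exists>z. \<theta> g = to_circle z \<and> \<bar>z\<bar> < 4 / n"
  proof (cases "\<rho> h = id")
    case True
    obtain v where "v \<in> carrier homeo_circle_plus" "v \<circ> v \<circ> v = id" "\<rho> (rotations g1) = v"
      using tool'[of 1] n True by auto
    then obtain t where t: "\<theta> g1 = to_circle t" "3 * t \<in> \<int>" using rot_order_three unfolding \<theta>_def by metis
    have "12 * t = 4 * (3 * t)" by simp
    then have "12 * t \<in> \<int>" using t(2) by (metis Ints_mult Ints_numeral)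
    moreover have "\<theta> g = to_circle (12 * t)" using \<theta>_scale[OF g1 t(1), of 12] unfolding g12 by simp
    ultimately have "\<theta> g = to_circle 0" by (simp add: to_circle_eq_iff)
    then show ?thesis using n by (intro exI[of _ 0]) auto
  next
    case False
    have "\<exists>t. to_circle (real j * y) = to_circle t \<and> (\<bar>t\<bar> < 1 / 3 \<or> 2 * t \<in> \<int>)" if j: "j \<in> {1..n}" for j
    proof -
      have "\<theta> (\<lambda>r. real j * g1 r) = to_circle (real j * y)" using \<theta>_scale[OF g1 y] by blast
      then show ?thesis using tool'[OF j] False rot_modular unfolding \<theta>_def by metis
    qed
    then obtain y' where y': "to_circle y = to_circle y'" "\<bar>y'\<bar> < 1 / (3 * n) \<or> 4 * y' \<in> \<int>"
      using multiples_avoiding_middle_third[OF n] by blast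
    have \<theta>y': "\<theta> g = to_circle (12 * y')" using \<theta>_scale[OF g1, of y' 12] y y'(1) unfolding g12 by simp
    show ?thesis
    proof (cases "4 * y' \<in> \<int>")
      case True
      have "12 * y' = 3 * (4 * y')" by simp
      then have "12 * y' \<in> \<int>" using True by (metis Ints_mult Ints_numeral)
      then have "\<theta> g = to_circle 0" using \<theta>y' by (simp add: to_circle_eq_iff)
      then show ?thesis using n by (intro exI[of _ 0]) auto
    next
      case False
      then have "\<bar>y'\<bar> < 1 / (3 * n)" using y'(2) by blast
      moreover have "\<bar>12 * y'\<bar> = 12 * \<bar>y'\<bar>" by (simp add: abs_mult)
      ultimately have "\<bar>12 * y'\<bar> < 4 / n" by simp
      then show ?thesis using \<theta>y' by blast
    qed
  qed
  then show ?thesis using g by blast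
qed

end

text \<open>The height 1/M makes \<open>M\<close> times the tuple integral, while \<open>i\<close>
  times it approximates the coordinate \<open>r\<close> on the \<open>i\<close>-th piece of
  \<open>I\<close>, with the error \<open>remainder_fun\<close>.\<close>

definition step_fun :: "real set \<Rightarrow> nat \<Rightarrow> nat \<Rightarrow> real \<Rightarrow> real"
  where "step_fun I M i r = (if r \<in> I \<and> \<lfloor>real M * r\<rfloor> = int i then 1 / real M else 0)"

definition remainder_fun :: "real set \<Rightarrow> nat \<Rightarrow> real \<Rightarrow> real"
  where "remainder_fun I M r = (if r \<in> I then r - of_int \<lfloor>real M * r\<rfloor> / real M else 0)"

text \<open>The factor \<open>1 / 12\<close> removes the exceptional cases in which the rotation numbers of small multiples
  of an angle \<open>y\<close> are bounded because \<open>3 * y\<close> or \<open>4 * y\<close> is an integer.\<close>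

definition small_functions :: "real set \<Rightarrow> (real \<Rightarrow> real) set"
  where "small_functions I = {f. (\<forall>r. \<bar>f r\<bar> \<le> 1 / 6) \<and>
    ((\<exists>M i i' (c :: int) (j :: nat). f = (\<lambda>r. real j / 12 * (step_fun I M i r + of_int c * step_fun I M i' r))) \<or>
     (\<exists>M (j :: nat). f = (\<lambda>r. real j / 12 * remainder_fun I M r)))}"

lemma countable_small_functions: "countable (small_functions I)"
proof (rule countable_subset)
  show "small_functions I \<subseteq>
      range (\<lambda>(M, i, i', c :: int, j :: nat). \<lambda>r. real j / 12 * (step_fun I M i r + of_int c * step_fun I M i' r))
      \<union> range (\<lambda>(M, j :: nat). \<lambda>r. real j / 12 * remainder_fun I M r)" (is "_ \<subseteq> ?A \<union> ?B")
  proof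
    fix f assume "f \<in> small_functions I"
    then consider M i i' c j where "f = (\<lambda>r. real j / 12 * (step_fun I M i r + of_int c * step_fun I M i' r))"
      | M j where "f = (\<lambda>r. real j / 12 * remainder_fun I M r)"
      unfolding small_functions_def by blast
    then show "f \<in> ?A \<union> ?B"
    proof cases
      case 1
      then show ?thesis by (intro UnI1 image_eqI[of _ _ "(M, i, i', c, j)"]) auto
    next
      case 2
      then show ?thesis by (intro UnI2 image_eqI[of _ _ "(M, j)"]) auto
    qed
  qed
qed auto

text \<open>The last relation makes \<open>u\<close> conjugate to an element that depends only on the support of \<open>f\<close>.  Hence
  \<open>u\<close> acts trivially either for all multiples of a given tuple of angles or for none of them.\<close>

definition modular_generators :: "real set \<Rightarrow> (real \<Rightarrow> circle \<Rightarrow> circle) set \<Rightarrow> bool"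
  where "modular_generators I S \<longleftrightarrow> (\<forall>f\<in>small_functions I.
    rotations (\<lambda>r. if f r = 0 then 0 else 1 / 2) \<in> S \<and>
    (\<exists>u\<in>S. \<exists>v\<in>S. \<exists>d\<in>S.
      u \<otimes>\<^bsub>power_group\<^esub> u = \<one>\<^bsub>power_group\<^esub> \<and>
      v \<otimes>\<^bsub>power_group\<^esub> v \<otimes>\<^bsub>power_group\<^esub> v = \<one>\<^bsub>power_group\<^esub> \<and>
      u \<otimes>\<^bsub>power_group\<^esub> v = rotations f \<and>
      d \<otimes>\<^bsub>power_group\<^esub> u = rotations (\<lambda>r. if f r = 0 then 0 else 1 / 2) \<otimes>\<^bsub>power_group\<^esub> d))"

text \<open>One choice of \<open>u\<close>, \<open>v\<close>, \<open>d\<close> for each angle is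
  applied coordinatewise, so the relations hold in every coordinate.\<close>

lemma modular_generators_exist:
  "\<exists>S. S \<subseteq> carrier power_group \<and> countable S \<and> modular_generators I S"
proof -
  have "\<forall>s. \<exists>u v d. \<bar>s\<bar> \<le> 1 / 6 \<longrightarrow> u \<in> carrier homeo_circle_plus \<and> v \<in> carrier homeo_circle_plus \<and>
    d \<in> carrier homeo_circle_plus \<and> u \<circ> u = id \<and> v \<circ> v \<circ> v = id \<and> u \<circ> v = circ (\<lambda>x. x + s) \<and>
    d \<circ> u = circ (\<lambda>x. x + (if s = 0 then 0 else 1 / 2)) \<circ> d"
    using rotation_modular by meson
  then obtain u v d where uvd: "\<And>s. \<bar>s\<bar> \<le> 1 / 6 \<Longrightarrow> u s \<in> carrier homeo_circle_plus \<and> v s \<in> carrier homeo_circle_plus \<and>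
    d s \<in> carrier homeo_circle_plus \<and> u s \<circ> u s = id \<and> v s \<circ> v s \<circ> v s = id \<and> u s \<circ> v s = circ (\<lambda>x. x + s) \<and>
    d s \<circ> u s = circ (\<lambda>x. x + (if s = 0 then 0 else 1 / 2)) \<circ> d s"
    by metis
  define S where "S = (\<Union>f\<in>small_functions I. {\<lambda>r. u (f r), \<lambda>r. v (f r), \<lambda>r. d (f r),
    rotations (\<lambda>r. if f r = 0 then 0 else 1 / 2)})"
  have small: "\<bar>f r\<bar> \<le> 1 / 6" if "f \<in> small_functions I" for f r
    using that by (auto simp: small_functions_def)
  have sub: "S \<subseteq> carrier power_group"
  proof
    fix x assume "x \<in> S"
    then obtain f where f: "f \<in> small_functions I" and "x \<in> {\<lambda>r. u (f r), \<lambda>r. v (f r), \<lambda>r. d (f r),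
      rotations (\<lambda>r. if f r = 0 then 0 else 1 / 2)}" unfolding S_def by blast
    then show "x \<in> carrier power_group"
      using uvd[OF small[OF f]] rotations_in_power_group by (auto simp: power_group_def)
  qed
  have count: "countable S"
    unfolding S_def by (rule countable_UN[OF countable_small_functions]) simp
  have tool: "\<exists>u\<in>S. \<exists>v\<in>S. \<exists>d\<in>S.
      u \<otimes>\<^bsub>power_group\<^esub> u = \<one>\<^bsub>power_group\<^esub> \<and>
      v \<otimes>\<^bsub>power_group\<^esub> v \<otimes>\<^bsub>power_group\<^esub> v = \<one>\<^bsub>power_group\<^esub> \<and>
      u \<otimes>\<^bsub>power_group\<^esub> v = rotations f \<and>
      d \<otimes>\<^bsub>power_group\<^esub> u = rotations (\<lambda>r. if f r = 0 then 0 else 1 / 2) \<otimes>\<^bsub>power_group\<^esub> d"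
    if f: "f \<in> small_functions I" for f
  proof (intro bexI conjI)
    show "(\<lambda>r. u (f r)) \<otimes>\<^bsub>power_group\<^esub> (\<lambda>r. u (f r)) = \<one>\<^bsub>power_group\<^esub>"
      "(\<lambda>r. v (f r)) \<otimes>\<^bsub>power_group\<^esub> (\<lambda>r. v (f r)) \<otimes>\<^bsub>power_group\<^esub> (\<lambda>r. v (f r)) = \<one>\<^bsub>power_group\<^esub>"
      "(\<lambda>r. u (f r)) \<otimes>\<^bsub>power_group\<^esub> (\<lambda>r. v (f r)) = rotations f"
      "(\<lambda>r. d (f r)) \<otimes>\<^bsub>power_group\<^esub> (\<lambda>r. u (f r)) =
        rotations (\<lambda>r. if f r = 0 then 0 else 1 / 2) \<otimes>\<^bsub>power_group\<^esub> (\<lambda>r. d (f r))"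
      using uvd[OF small[OF f]] by (auto simp: power_group_def rotations_def)
  qed (use f in \<open>auto simp: S_def\<close>)
  have half: "rotations (\<lambda>r. if f r = 0 then 0 else 1 / 2) \<in> S" if "f \<in> small_functions I" for f
    using that by (auto simp: S_def)
  show ?thesis
    unfolding modular_generators_def by (intro exI[of _ S] conjI ballI sub count half tool)
qed

section \<open>Realizing a closed symmetric set\<close>

context rotation_action
begin

text \<open>Angles up to 1/M may be multiplied by \<open>j / 12\<close> with \<open>j\<close> up to
  \<open>2 * M\<close> before they exceed 1/6; with \<open>n = 2 * M\<close> the bound 4/n becomes
  2/M.\<close>

lemma \<theta>_small_function:
  assumes gens: "modular_generators I S" and M: "M \<ge> 2" and bound: "\<And>r. \<bar>g r\<bar> \<le> 1 / real M"
    and g: "(\<exists>i i' (c :: int). g = (\<lambda>r. step_fun I M i r + of_int c * step_fun I M i' r)) \<or> g = remainder_fun I M"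
  shows "rotations g \<in> \<Gamma> \<and> (\<exists>z. \<theta> g = to_circle z \<and> \<bar>z\<bar> < 2 / M)"
proof -
  have small: "(\<lambda>r. real j / 12 * g r) \<in> small_functions I" if j: "j \<in> {1..2 * M}" for j
  proof -
    have "\<bar>real j / 12 * g r\<bar> \<le> 1 / 6" for r
    proof -
      have "\<bar>real j / 12 * g r\<bar> = real j / 12 * \<bar>g r\<bar>" by (simp add: abs_mult)
      also have "\<dots> \<le> real (2 * M) / 12 * (1 / real M)"
        using j bound[of r] by (intro mult_mono divide_right_mono) auto
      also have "\<dots> = 1 / 6" using M by simp
      finally show ?thesis .
    qed
    note bound' = this
    from g show ?thesis
    proof (elim disjE exE)
      fix i i' c assume "g = (\<lambda>r. step_fun I M i r + of_int c * step_fun I M i' r)"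
      then show ?thesis unfolding small_functions_def using bound' by blast
    next
      assume "g = remainder_fun I M"
      then show ?thesis unfolding small_functions_def using bound' by blast
    qed
  qed
  define h where "h = rotations (\<lambda>r. if g r = 0 then 0 else 1 / 2)"
  \<comment> \<open>As \<open>j\<close> is positive, all these multiples have the same support, so a
    single \<open>h\<close> serves them all.\<close>
  have half: "rotations (\<lambda>r. if real j / 12 * g r = 0 then 0 else 1 / 2) = h" if "j \<in> {1..2 * M}" for j
    unfolding h_def using that by (intro arg_cong[of _ _ rotations]) auto
  have "rotations g \<in> \<Gamma> \<and> (\<exists>z. \<theta> g = to_circle z \<and> \<bar>z\<bar> < 4 / real (2 * M))"
  proof (rule \<theta>_small[of _ h])
    show "3 \<le> 2 * M" using M by simp
    have "1 \<in> {1..2 * M}" using M by simp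
    from small[OF this] half[OF this] show "h \<in> \<Gamma>"
      using gens unfolding modular_generators_def by (metis generate.incl)
    fix j assume j: "j \<in> {1..2 * M}"
    show "\<exists>u\<in>\<Gamma>. \<exists>v\<in>\<Gamma>. \<exists>d\<in>\<Gamma>.
      u \<otimes>\<^bsub>power_group\<^esub> u = \<one>\<^bsub>power_group\<^esub> \<and>
      v \<otimes>\<^bsub>power_group\<^esub> v \<otimes>\<^bsub>power_group\<^esub> v = \<one>\<^bsub>power_group\<^esub> \<and>
      u \<otimes>\<^bsub>power_group\<^esub> v = rotations (\<lambda>r. real j / 12 * g r) \<and>
      d \<otimes>\<^bsub>power_group\<^esub> u = h \<otimes>\<^bsub>power_group\<^esub> d"
      using gens small[OF j] half[OF j] unfolding modular_generators_def by (metis generate.incl)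
  qed
  then show ?thesis by simp
qed

text \<open>\<open>M\<close> times the tuple is integral, so its rotation number is a multiple of
  1/M; being below 2/M leaves only -1/M, 0 and 1/M.\<close>

lemma \<theta>_step:
  assumes gens: "modular_generators I S" and M: "M \<ge> 2" and "i \<noteq> i'" and c: "c \<in> {-1, 0, 1 :: int}"
  defines "g \<equiv> (\<lambda>r. step_fun I M i r + of_int c * step_fun I M i' r)"
  shows "rotations g \<in> \<Gamma> \<and> (\<exists>k::int. \<theta> g = to_circle (of_int k / real M) \<and> \<bar>k\<bar> \<le> 1)"
proof -
  have "\<bar>g r\<bar> \<le> 1 / real M" for r
    using \<open>i \<noteq> i'\<close> c by (auto simp: g_def step_fun_def)
  then have g: "rotations g \<in> \<Gamma>" "\<exists>z. \<theta> g = to_circle z \<and> \<bar>z\<bar> < 2 / M"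
    using \<theta>_small_function[OF gens M, of g] unfolding g_def by blast+
  then obtain z where z: "\<theta> g = to_circle z" "\<bar>z\<bar> < 2 / M" by blast
  have "\<theta> (\<lambda>r. real M * g r) = to_circle (real M * z)" using \<theta>_scale[OF g(1) z(1)] by blast
  moreover have "real M * g r \<in> \<int>" for r using M \<open>i \<noteq> i'\<close> by (auto simp: g_def step_fun_def)
  ultimately have "real M * z \<in> \<int>" using \<theta>_Ints(2) by (metis to_circle_eq_0_iff)
  then obtain k where k: "real M * z = of_int k" by (auto elim: Ints_cases)
  then have zk: "z = of_int k / real M" using M by (simp add: field_simps)
  have "real M * \<bar>z\<bar> < real M * (2 / M)" using z(2) M by (intro mult_strict_left_mono) auto
  then have "\<bar>real M * z\<bar> < 2" using M by (simp add: abs_mult)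
  then have "\<bar>k\<bar> \<le> 1" unfolding k by linarith
  then show ?thesis using g z zk by blast
qed

text \<open>If \<open>k i\<close> and \<open>k i'\<close> are both nonzero, the sum or the
  difference of the two step functions would have rotation number 2/M or -2/M, against
  \<open>\<theta>_step\<close>. The condition \<open>M \<ge> 4\<close> keeps numerators that differ
  by at most 3 distinct modulo \<open>M\<close>.\<close>

lemma \<theta>_steps:
  assumes gens: "modular_generators I S" and M: "M \<ge> 4"
  shows "\<exists>k :: nat \<Rightarrow> int. (\<forall>i. rotations (step_fun I M i) \<in> \<Gamma> \<and>
      \<theta> (step_fun I M i) = to_circle (of_int (k i) / real M) \<and> \<bar>k i\<bar> \<le> 1) \<and>
    (\<forall>i i'. i \<noteq> i' \<longrightarrow> k i = 0 \<or> k i' = 0)"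
proof -
  have "\<exists>k::int. rotations (step_fun I M i) \<in> \<Gamma> \<and> \<theta> (step_fun I M i) = to_circle (of_int k / real M) \<and> \<bar>k\<bar> \<le> 1" for i
    using \<theta>_step[OF gens, of M i "Suc i" 0] M by auto
  then obtain k where k: "\<And>i. rotations (step_fun I M i) \<in> \<Gamma>"
    "\<And>i. \<theta> (step_fun I M i) = to_circle (of_int (k i) / real M)" "\<And>i. \<bar>k i\<bar> \<le> (1 :: int)" by metis
  have same: False
    if eq: "to_circle (of_int a / real M) = to_circle (of_int b / real M)" "a \<noteq> b" "\<bar>a - b\<bar> \<le> 3" for a b :: int
  proof -
    obtain m where "of_int a / real M = of_int b / real M + of_int m"
      using eq(1) by (rule to_circle_eqE)
    then have "of_int a = real_of_int b + of_int m * real M" using M by (simp add: field_simps)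
    then have "real_of_int a = of_int (b + m * int M)" by simp
    then have ab: "a - b = m * int M" by linarith
    then have "m \<noteq> 0" using eq by auto
    then have "1 * int M \<le> \<bar>m\<bar> * int M" by (intro mult_right_mono) auto
    moreover have "\<bar>m\<bar> * int M \<le> 3" using eq(3) unfolding ab by (simp add: abs_mult)
    ultimately show False using M by linarith
  qed
  have "k i = 0 \<or> k i' = 0" if ne: "i \<noteq> i'" for i i'
  proof (rule ccontr)
    assume "\<not> (k i = 0 \<or> k i' = 0)"
    then have ki: "k i = 1 \<or> k i = -1" "k i' = 1 \<or> k i' = -1" using k(3)[of i] k(3)[of i'] by linarith+
    show False
    proof (cases "k i = k i'")
      case True
      obtain l where l: "\<theta> (\<lambda>r. step_fun I M i r + of_int 1 * step_fun I M i' r) = to_circle (of_int l / real M)" "\<bar>l\<bar> \<le> 1"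
        using \<theta>_step[OF gens, of M i i' 1] M ne by auto
      have "to_circle (of_int l / real M) = to_circle (of_int (k i) / real M + of_int (k i') / real M)"
        using l(1) \<theta>_add[OF k(1) k(1), of i i'] k(2) by (simp add: to_circle_add)
      moreover have "l \<noteq> k i + k i'" "\<bar>l - (k i + k i')\<bar> \<le> 3" using ki l(2) True by linarith+
      ultimately show False using same[of l "k i + k i'"] by (simp add: add_divide_distrib)
    next
      case False
      let ?d = "\<lambda>r. step_fun I M i r + of_int (-1) * step_fun I M i' r"
      obtain l where l: "\<theta> ?d = to_circle (of_int l / real M)" "\<bar>l\<bar> \<le> 1" and d: "rotations ?d \<in> \<Gamma>"
        using \<theta>_step[OF gens, of M i i' "-1"] M ne by auto
      have "\<theta> (step_fun I M i) = \<theta> ?d + \<theta> (step_fun I M i')"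
        using \<theta>_add[OF d k(1), of i'] by simp
      then have "to_circle (of_int (k i) / real M) = to_circle (of_int l / real M + of_int (k i') / real M)"
        unfolding l k(2) to_circle_add .
      moreover have "k i \<noteq> l + k i'" "\<bar>k i - (l + k i')\<bar> \<le> 3" using ki l(2) False by linarith+
      ultimately show False using same[of "k i" "l + k i'"] by (simp add: add_divide_distrib)
    qed
  qed
  then show ?thesis using k by blast
qed

text \<open>The tuple is the sum of \<open>i\<close> times the \<open>i\<close>-th step function
  plus a remainder. At most one step contributes, namely i/M or -i/M. The error 3/M is 2/M for the
  remainder and 1/M for replacing i/M by a point of \<open>I\<close> in that piece.\<close>

lemma \<theta>_approx:
  fixes M :: nat
  assumes gens: "modular_generators I S" and M: "M \<ge> 4" and I: "I \<subseteq> {0..1 / 2}" "0 \<in> I"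
  defines "a \<equiv> (\<lambda>r. if r \<in> I then r else 0)"
  shows "rotations a \<in> \<Gamma>" "\<exists>t r. \<theta> a = to_circle t \<and> (r \<in> I \<or> - r \<in> I) \<and> \<bar>t - r\<bar> < 3 / M"
proof -
  obtain k where k: "\<And>i. rotations (step_fun I M i) \<in> \<Gamma>"
    "\<And>i. \<theta> (step_fun I M i) = to_circle (of_int (k i) / real M)" "\<And>i. \<bar>k i\<bar> \<le> (1 :: int)"
    "\<And>i i'. i \<noteq> i' \<Longrightarrow> k i = 0 \<or> k i' = 0"
    using \<theta>_steps[OF gens M] by blast
  have sum: "rotations (\<lambda>r. \<Sum>i<n. real i * step_fun I M i r) \<in> \<Gamma> \<and>
    \<theta> (\<lambda>r. \<Sum>i<n. real i * step_fun I M i r) = to_circle (\<Sum>i<n. real i * (of_int (k i) / real M))" for n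
  proof (induction n)
    case 0
    show ?case using \<theta>_Ints[of "\<lambda>_. 0"] by (simp add: to_circle_0)
  next
    case (Suc n)
    have s: "rotations (\<lambda>r. real n * step_fun I M n r) \<in> \<Gamma>"
      "\<theta> (\<lambda>r. real n * step_fun I M n r) = to_circle (real n * (of_int (k n) / real M))"
      using \<theta>_scale[OF k(1,2)] by blast+
    show ?case
      using \<theta>_add[OF conjunct1[OF Suc] s(1)] rotations_add_closed[OF conjunct1[OF Suc] s(1)] Suc s
      by (simp add: to_circle_add)
  qed
  have "\<bar>remainder_fun I M r\<bar> \<le> 1 / real M" for r
  proof -
    have "\<bar>r - of_int \<lfloor>real M * r\<rfloor> / real M\<bar> = \<bar>real M * r - of_int \<lfloor>real M * r\<rfloor>\<bar> / real M"
      using M by (simp add: abs_if field_simps)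
    also have "\<dots> \<le> 1 / real M" by (intro divide_right_mono) linarith+
    finally show ?thesis by (simp add: remainder_fun_def)
  qed
  then obtain z where z: "rotations (remainder_fun I M) \<in> \<Gamma>" "\<theta> (remainder_fun I M) = to_circle z" "\<bar>z\<bar> < 2 / M"
    using \<theta>_small_function[OF gens, of M "remainder_fun I M"] M by auto
  have a: "a = (\<lambda>r. (\<Sum>i<M. real i * step_fun I M i r) + remainder_fun I M r)"
  proof
    fix r
    show "a r = (\<Sum>i<M. real i * step_fun I M i r) + remainder_fun I M r"
    proof (cases "r \<in> I")
      case True
      then have r: "0 \<le> r" "r \<le> 1 / 2" using I by auto
      define m where "m = nat \<lfloor>real M * r\<rfloor>"
      have m: "\<lfloor>real M * r\<rfloor> = int m" using r by (simp add: m_def)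
      have "real M * r \<le> real M * (1 / 2)" using r by (intro mult_left_mono) auto
      also have "\<dots> < real M" using M by simp
      finally have "real M * r < real M" .
      then have "m < M" using m by linarith
      have "(\<Sum>i<M. real i * step_fun I M i r) = (\<Sum>i<M. if i = m then real m / real M else 0)"
        using True m by (intro sum.cong) (auto simp: step_fun_def)
      also have "\<dots> = real m / real M" using \<open>m < M\<close> by simp
      finally show ?thesis using True m by (simp add: a_def remainder_fun_def)
    next
      case False
      then show ?thesis by (simp add: a_def remainder_fun_def step_fun_def)
    qed
  qed
  show "rotations a \<in> \<Gamma>" unfolding a using rotations_add_closed[OF conjunct1[OF sum[of M]] z(1)] .
  define w where "w = (\<Sum>i<M. real i * (of_int (k i) / real M))"
  have \<theta>a: "\<theta> a = to_circle (w + z)"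
    unfolding a using \<theta>_add[OF conjunct1[OF sum[of M]] z(1)] sum[of M] z(2) by (simp add: to_circle_add w_def)
  show "\<exists>t r. \<theta> a = to_circle t \<and> (r \<in> I \<or> - r \<in> I) \<and> \<bar>t - r\<bar> < 3 / M"
  proof (cases "\<exists>i<M. k i \<noteq> 0")
    case False
    then have "w = 0" unfolding w_def by (intro sum.neutral) auto
    then show ?thesis using \<theta>a z(3) I(2) by (intro exI[of _ "w + z"] exI[of _ 0]) auto
  next
    case True
    then obtain i where i: "i < M" "k i \<noteq> 0" by blast
    have "w = (\<Sum>j<M. if j = i then real i * (of_int (k i) / real M) else 0)"
      unfolding w_def using k(4) i(2) by (intro sum.cong) auto
    then have w: "w = real i * (of_int (k i) / real M)" using i by simp
    have ki: "k i = 1 \<or> k i = -1" using i(2) k(3)[of i] by linarith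
    \<comment> \<open>A contributing piece is not empty: over an empty piece the step function is 0,
      and so is its rotation number.\<close>
    have "\<exists>r\<in>I. \<lfloor>real M * r\<rfloor> = int i"
    proof (rule ccontr)
      assume "\<not> (\<exists>r\<in>I. \<lfloor>real M * r\<rfloor> = int i)"
      then have "step_fun I M i = (\<lambda>_. 0)" by (intro ext) (auto simp: step_fun_def)
      then have "of_int (k i) / real M \<in> \<int>" using k(2)[of i] \<theta>_Ints(2)[of "\<lambda>_. 0"] by (simp add: to_circle_eq_0_iff)
      then have "1 / real M \<in> \<int>" using ki minus_in_Ints_iff[of "1 / real M"] by auto
      then obtain m where "1 / real M = of_int m" by (auto elim: Ints_cases)
      moreover have "0 < 1 / real M" "1 / real M < 1" using M by auto
      ultimately show False by simp
    qed
    then obtain r where r: "r \<in> I" "\<lfloor>real M * r\<rfloor> = int i" by blast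
    have "real i \<le> real M * r" "real M * r < real i + 1" using r(2) by linarith+
    then have "real i / real M \<le> r" "r < real i / real M + 1 / real M" using M by (simp_all add: field_simps)
    moreover have "3 / real M = 2 / real M + 1 / real M" by (simp add: add_divide_distrib[symmetric])
    moreover have "z < 2 / real M" "- z < 2 / real M" using z(3) by linarith+
    ultimately have "\<bar>w + z - of_int (k i) * r\<bar> < 3 / M"
      using ki unfolding w abs_less_iff by (elim disjE) simp_all
    moreover have "of_int (k i) * r \<in> I \<or> - (of_int (k i) * r) \<in> I" using ki r(1) by auto
    ultimately show ?thesis using \<theta>a by blast
  qed
qed

end

text \<open>Coordinate projections realize the points of \<open>C\<close> in [0, 1/2], and reflected
  actions realize their negatives. Conversely \<open>\<theta>_approx\<close> puts each rotation
  number within 3/M of \<open>C\<close> for every large \<open>M\<close>, and \<open>C\<close> is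
  closed.\<close>

lemma closed_symmetric_realized:
  assumes C: "closed C" "0 \<in> C" "uminus ` C = C"
  shows "\<exists>(G :: (real \<Rightarrow> circle \<Rightarrow> circle) monoid) a. group G \<and> countable (carrier G) \<and> a \<in> carrier G \<and> rot_X G a = C"
proof -
  have minus: "- c \<in> C" if "c \<in> C" for c using C(3) that by blast
  define I where "I = {r. 0 \<le> r \<and> r \<le> 1 / 2 \<and> to_circle r \<in> C}"
  have I: "I \<subseteq> {0..1 / 2}" "0 \<in> I" using C(2) by (auto simp: I_def to_circle_0)
  define a where "a = (\<lambda>r. if r \<in> I then r else 0)"
  obtain S where S: "S \<subseteq> carrier power_group" "countable S" "modular_generators I S"
    using modular_generators_exist[of I] by blast
  define G where "G = power_group\<lparr>carrier := generate power_group S\<rparr>"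
  have grp: "group G" unfolding G_def
    by (rule group.subgroup_imp_group[OF group_power_group group.generate_is_subgroup[OF group_power_group S(1)]])
  have count: "countable (carrier G)"
    using group.countable_generate[OF group_power_group S(1,2)] by (simp add: G_def)
  have action: "rotation_action S \<rho>" if "\<rho> \<in> hom G homeo_circle_plus" for \<rho>
    using that S(1) unfolding G_def by unfold_locales
  \<comment> \<open>Membership of the angle tuple in the group is proved for a given action; the
    trivial one supplies it.\<close>
  have one: "(\<lambda>_. id) \<in> hom G homeo_circle_plus" using homeo_circle_plus_id by (auto simp: hom_def)
  have aG: "rotations a \<in> carrier G"
    using rotation_action.\<theta>_approx(1)[OF action[OF one] S(3) _ I, of 4] by (simp add: a_def G_def)
  have "c \<in> C" if c: "c \<in> rot_X G (rotations a)" for c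
  proof -
    obtain \<rho> where \<rho>: "\<rho> \<in> hom G homeo_circle_plus" "c = rot (\<rho> (rotations a))"
      using c by (auto simp: rot_X_def)
    obtain t where t: "c = to_circle t" by (rule to_circle_cases)
    have approx: "\<exists>s. to_circle s \<in> C \<and> \<bar>t - s\<bar> < 3 / real M" if M: "M \<ge> 4" for M
    proof -
      obtain t' r where t': "c = to_circle t'" "r \<in> I \<or> - r \<in> I" "\<bar>t' - r\<bar> < 3 / M"
        using rotation_action.\<theta>_approx(2)[OF action[OF \<rho>(1)] S(3) M I]
          rotation_action.\<theta>_def[OF action[OF \<rho>(1)], of a] \<rho>(2) unfolding a_def by metis
      have "to_circle t = to_circle t'" using t t'(1) by simp
      then obtain m where m: "t = t' + of_int m" by (rule to_circle_eqE)
      have "to_circle r \<in> C"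
        using t'(2) minus[of "to_circle (- r)"] by (auto simp: I_def to_circle_minus)
      then have "to_circle (r + of_int m) \<in> C" by simp
      moreover have "\<bar>t - (r + of_int m)\<bar> < 3 / M" using t'(3) m by simp
      ultimately show ?thesis by blast
    qed
    have "t \<in> closure (to_circle -` C)"
      unfolding closure_approachable
    proof (intro allI impI)
      fix e :: real assume e: "e > 0"
      obtain N where N: "3 / e < real N" using reals_Archimedean2 by blast
      define M where "M = max N 4"
      have "3 / e < real M" using N by (simp add: M_def)
      then have "3 / real M < e" using e by (simp add: M_def field_simps)
      moreover obtain s where "to_circle s \<in> C" "\<bar>t - s\<bar> < 3 / real M" using approx[of M] by (auto simp: M_def)
      ultimately show "\<exists>y\<in>to_circle -` C. dist y t < e"
        by (intro bexI[of _ s]) (auto simp: dist_real_def)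
    qed
    then show ?thesis using C(1) t by (simp add: closed_circle_iff)
  qed
  moreover have "c \<in> rot_X G (rotations a)" if c: "c \<in> C" for c
  proof -
    have proj: "to_circle r \<in> rot_X G (rotations a)" if r: "r \<in> I" for r
    proof -
      have "(\<lambda>\<phi>. \<phi> r) \<in> hom G homeo_circle_plus"
        using group.generate_in_carrier[OF group_power_group S(1)]
        by (auto simp: hom_def G_def power_group_def)
      moreover have "rot (rotations a r) = to_circle r"
        using rot_circ[OF deg1_translation(1), of r] r by (simp add: rotations_def a_def trans_num_translation)
      ultimately show ?thesis by (intro rot_XI[of "\<lambda>\<phi>. \<phi> r"]) simp_all
    qed
    obtain t where t: "c = to_circle t" by (rule to_circle_cases)
    define s where "s = t - of_int (round t)"
    have s: "c = to_circle s" "\<bar>s\<bar> \<le> 1 / 2"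
      using of_int_round_abs_le[of t] by (auto simp: s_def t to_circle_eq_iff abs_minus_commute)
    show ?thesis
    proof (cases "s \<ge> 0")
      case True
      then show ?thesis using proj[of s] s c by (simp add: I_def)
    next
      case False
      then have "to_circle (- s) \<in> rot_X G (rotations a)"
        using proj[of "- s"] s c minus[of c] by (simp add: I_def to_circle_minus)
      then show ?thesis using rot_X_uminus[OF aG] s(1) by (fastforce simp: to_circle_minus)
    qed
  qed
  ultimately have "rot_X G (rotations a) = C" by blast
  then show ?thesis using grp count aG by blast
qed

section \<open>Closedness of the set of rotation numbers\<close>

text \<open>The first letter acts first, so prepending \<open>k\<close> to a word means precomposing
  its map with \<open>F k\<close>.\<close>

primrec word_map :: "(nat \<Rightarrow> real \<Rightarrow> real) \<Rightarrow> nat list \<Rightarrow> real \<Rightarrow> real"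
  where "word_map F [] = id"
  | "word_map F (k # l) = word_map F l \<circ> F k"

text \<open>Prepending the letter \<open>k\<close> increases the code at most by a factor of about \<open>2 ^ Suc k\<close>, so that
  summable weights can be chosen that decrease only by a factor depending on \<open>k\<close>.\<close>

primrec word_code :: "nat list \<Rightarrow> nat"
  where "word_code [] = 0"
  | "word_code (k # l) = 2 ^ k * (2 * word_code l + 1)"

lemma power2_odd_inject:
  "2 ^ k * (2 * m + 1) = 2 ^ k' * (2 * m' + 1 :: nat) \<Longrightarrow> k = k' \<and> m = m'"
proof (induction k arbitrary: k')
  case 0
  then show ?case by (cases k') (auto, presburger)
next
  case (Suc k)
  then show ?case
  proof (cases k')
    case 0
    with Suc.prems have "2 * (2 ^ k * (2 * m + 1)) = 2 * m' + 1" by simp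
    then show ?thesis by presburger
  next
    case (Suc k'')
    with Suc.prems have "2 ^ k * (2 * m + 1) = 2 ^ k'' * (2 * m' + 1)" by simp
    then show ?thesis using Suc.IH Suc by blast
  qed
qed

lemma inj_word_code: "inj word_code"
proof (rule injI)
  fix l l' show "word_code l = word_code l' \<Longrightarrow> l = l'"
  proof (induction l arbitrary: l')
    case Nil
    then show ?case by (cases l') auto
  next
    case (Cons k l)
    show ?case
    proof (cases l')
      case Nil
      then show ?thesis using Cons.prems by simp
    next
      case (Cons k' l'')
      then show ?thesis using Cons.prems Cons.IH power2_odd_inject[of k "word_code l" k' "word_code l''"] by simp
    qed
  qed
qed

lemma power2_odd_ex: "n > 0 \<Longrightarrow> \<exists>k m. n = 2 ^ k * (2 * m + 1 :: nat)"
proof (induction n rule: less_induct)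
  case (less n)
  show ?case
  proof (cases "even n")
    case True
    then obtain n' where n': "n = 2 * n'" by (elim evenE)
    then have "n' < n" "n' > 0" using less.prems by auto
    then obtain k m where "n' = 2 ^ k * (2 * m + 1)" using less.IH by blast
    then have "n = 2 ^ Suc k * (2 * m + 1)" using n' by simp
    then show ?thesis by blast
  next
    case False
    then obtain m where "n = 2 * m + 1" by (elim oddE)
    then have "n = 2 ^ 0 * (2 * m + 1)" by simp
    then show ?thesis by blast
  qed
qed

lemma surj_word_code: "surj word_code"
proof -
  have "\<exists>l. word_code l = n" for n
  proof (induction n rule: less_induct)
    case (less n)
    show ?case
    proof (cases "n = 0")
      case True
      then show ?thesis by (intro exI[of _ "[]"]) simp
    next
      case False
      then obtain k m where km: "n = 2 ^ k * (2 * m + 1)" using power2_odd_ex by blast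
      have "1 * (2 * m + 1) \<le> 2 ^ k * (2 * m + 1)" by (intro mult_right_mono) simp_all
      then have "2 * m + 1 \<le> n" unfolding km by simp
      then have "m < n" by simp
      then obtain l where "word_code l = m" using less by blast
      then show ?thesis using km by (intro exI[of _ "k # l"]) simp
    qed
  qed
  then show ?thesis by (metis surjI)
qed

lemma deg1_word_map: "(\<And>k. deg1 (F k)) \<Longrightarrow> deg1 (word_map F l)"
  by (induction l) (auto intro: deg1_compose)

text \<open>\<Phi> averages all words. Precomposing with \<open>F k\<close> sends the increment of
  word \<open>n\<close> to that of word \<open>\<iota> k n\<close>, which already occurs in the
  average, with a weight smaller by a factor of at most \<open>4 ^ Suc k\<close>. The constant thus
  depends on the letter but not on the maps.\<close>

lemma lipschitz_coordinate:
  fixes F :: "nat \<Rightarrow> real \<Rightarrow> real"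
  assumes F: "\<And>k. deg1 (F k)"
  shows "\<exists>P. deg1 P \<and> P 0 = 0 \<and> (\<forall>k x y. x \<le> y \<longrightarrow> P (F k y) - P (F k x) \<le> 4 ^ Suc k * (P y - P x))"
proof -
  define B where "B n = word_map F (inv_into UNIV word_code n)" for n
  define \<iota> where "\<iota> k n = 2 ^ k * (2 * n + 1)" for k n :: nat
  define w where "w n = inverse ((real (Suc n))\<^sup>2)" for n
  define W where "W = (\<Sum>n. w n)"
  \<comment> \<open>Subtracting \<open>x\<close> leaves a term bounded by \<open>w n\<close>, so the
    series converges uniformly; \<open>W * x\<close> in \<Phi> restores what was subtracted.\<close>
  define h where "h n x = w n * (B n x - B n 0 - x)" for n x
  define \<Phi> where "\<Phi> x = (\<Sum>n. h n x) + W * x" for x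
  have B: "deg1 (B n)" for n unfolding B_def by (intro deg1_word_map F)
  have B\<iota>: "B (\<iota> k n) = B n \<circ> F k" for k n
  proof -
    have "word_code (k # inv_into UNIV word_code n) = \<iota> k n"
      by (simp add: \<iota>_def surj_f_inv_f[OF surj_word_code])
    then have "inv_into UNIV word_code (\<iota> k n) = k # inv_into UNIV word_code n"
      using inv_f_f[OF inj_word_code] by metis
    then show ?thesis by (simp add: B_def)
  qed
  have w: "w n > 0" for n by (simp add: w_def)
  have sw: "summable w"
    using inverse_power_summable[of 2, where 'a = real] unfolding w_def
    by (subst summable_Suc_iff) simp
  have hb: "\<bar>h n x\<bar> \<le> w n" for n x
  proof -
    have "\<bar>B n x - B n 0 - x\<bar> \<le> 1" using deg1_displacement[OF B, of n x 0] by simp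
    then have "w n * \<bar>B n x - B n 0 - x\<bar> \<le> w n * 1" using w[of n] by (intro mult_left_mono) auto
    then show ?thesis using w[of n] by (simp add: h_def abs_mult)
  qed
  have sh: "summable (\<lambda>n. h n x)" for x
    by (rule summable_comparison_test'[OF sw]) (use hb in auto)
  have incr: "summable (\<lambda>n. w n * (B n y - B n x))" "\<Phi> y - \<Phi> x = (\<Sum>n. w n * (B n y - B n x))" for x y
  proof -
    have eq: "w n * (B n y - B n x) = h n y - h n x + w n * (y - x)" for n
      by (simp add: h_def algebra_simps)
    have s: "summable (\<lambda>n. h n y - h n x)" "summable (\<lambda>n. w n * (y - x))"
      by (intro summable_diff sh summable_mult2 sw)+
    show "summable (\<lambda>n. w n * (B n y - B n x))" unfolding eq by (rule summable_add[OF s])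
    have "(\<Sum>n. w n * (B n y - B n x)) = (\<Sum>n. h n y) - (\<Sum>n. h n x) + W * (y - x)"
      unfolding eq W_def suminf_add[OF s, symmetric] suminf_diff[OF sh sh, symmetric] suminf_mult2[OF sw, symmetric] ..
    then show "\<Phi> y - \<Phi> x = (\<Sum>n. w n * (B n y - B n x))" by (simp add: \<Phi>_def algebra_simps)
  qed
  have Wpos: "W > 0" unfolding W_def by (rule suminf_pos[OF sw w])
  have contB: "continuous_on UNIV (h n)" for n
    unfolding h_def by (intro continuous_on_mult continuous_on_diff continuous_on_const continuous_on_id deg1_cont B)
  have "uniform_limit UNIV (\<lambda>n x. \<Sum>i<n. h i x) (\<lambda>x. \<Sum>i. h i x) sequentially"
    by (rule Weierstrass_m_test[OF _ sw]) (use hb in auto)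
  then have "continuous_on UNIV (\<lambda>x. \<Sum>i. h i x)"
    by (rule uniform_limit_theorem[rotated]) (simp, intro always_eventually allI continuous_on_sum contB)
  then have cont: "continuous_on UNIV \<Phi>"
    unfolding \<Phi>_def by (intro continuous_on_add continuous_on_mult continuous_on_const continuous_on_id)
  have less: "\<Phi> x < \<Phi> y" if "x < y" for x y
  proof -
    have "0 < (\<Sum>n. w n * (B n y - B n x))"
      by (rule suminf_pos[OF incr(1)]) (use w that in \<open>auto simp: deg1_less_iff[OF B]\<close>)
    then show ?thesis using incr(2)[of y x] by simp
  qed
  have one: "\<Phi> (x + 1) = \<Phi> x + W" for x
    using incr(2)[of "x + 1" x] by (simp add: deg1_one[OF B] W_def)
  have lip: "\<Phi> (F k y) - \<Phi> (F k x) \<le> 4 ^ Suc k * (\<Phi> y - \<Phi> x)" if xy: "x \<le> y" for k x y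
  proof -
    define d where "d n = B n y - B n x" for n
    have d: "d n \<ge> 0" for n using xy by (simp add: d_def deg1_le_iff[OF B])
    have inj: "inj (\<iota> k)" by (auto simp: inj_on_def \<iota>_def)
    have sd: "summable (\<lambda>n. w n * d n)" unfolding d_def by (rule incr)
    have s: "summable ((\<lambda>n. w n * d n) \<circ> \<iota> k)"
      by (rule summable_reindex[OF sd inj]) (use w d in \<open>simp add: less_imp_le\<close>)
    have "w n \<le> 4 ^ Suc k * w (\<iota> k n)" for n
    proof -
      have "(1::nat) \<le> 2 ^ k" by simp
      then have "Suc (\<iota> k n) \<le> 2 ^ Suc k * Suc n" by (simp add: \<iota>_def algebra_simps)
      then have "real (Suc (\<iota> k n)) \<le> real (2 ^ Suc k * Suc n)" by (rule of_nat_mono)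
      then have "real (Suc (\<iota> k n)) \<le> 2 ^ Suc k * real (Suc n)"
        by (simp only: of_nat_mult of_nat_power of_nat_numeral)
      then have "(real (Suc (\<iota> k n)))\<^sup>2 \<le> (2 ^ Suc k * real (Suc n))\<^sup>2" by (rule power_mono) simp
      also have "\<dots> = 4 ^ Suc k * (real (Suc n))\<^sup>2"
        by (simp only: power_mult_distrib power_even_eq[symmetric] power_mult[symmetric] mult.commute[of _ 2]) (simp add: power_mult)
      finally have "inverse (4 ^ Suc k * (real (Suc n))\<^sup>2) \<le> w (\<iota> k n)"
        unfolding w_def by (intro le_imp_inverse_le) auto
      then have "4 ^ Suc k * inverse (4 ^ Suc k * (real (Suc n))\<^sup>2) \<le> 4 ^ Suc k * w (\<iota> k n)"
        by (intro mult_left_mono) auto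
      then show ?thesis by (simp add: w_def field_simps)
    qed
    note ww = this
    have le: "w n * d (\<iota> k n) \<le> 4 ^ Suc k * ((\<lambda>n. w n * d n) \<circ> \<iota> k) n" for n
      using mult_right_mono[OF ww[of n] d[of "\<iota> k n"]] by (simp only: comp_apply mult.assoc)
    have dF: "w n * (B n (F k y) - B n (F k x)) = w n * d (\<iota> k n)" for n
      by (simp add: d_def B\<iota>)
    have "\<Phi> (F k y) - \<Phi> (F k x) = (\<Sum>n. w n * d (\<iota> k n))"
      unfolding incr(2) dF ..
    also have "\<dots> \<le> (\<Sum>n. 4 ^ Suc k * ((\<lambda>n. w n * d n) \<circ> \<iota> k) n)"
      by (rule suminf_le[OF le]) (use incr(1)[of "F k y" "F k x"] s in \<open>auto simp only: dF intro!: summable_mult\<close>)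
    also have "\<dots> = 4 ^ Suc k * (\<Sum>n. ((\<lambda>n. w n * d n) \<circ> \<iota> k) n)" by (rule suminf_mult[OF s])
    also have "(\<Sum>n. ((\<lambda>n. w n * d n) \<circ> \<iota> k) n) \<le> (\<Sum>n. w n * d n)"
      by (rule suminf_reindex_mono[OF sd inj]) (use w d in \<open>simp add: less_imp_le\<close>)
    also have "(\<Sum>n. w n * d n) = \<Phi> y - \<Phi> x" by (simp add: incr(2) d_def)
    finally show ?thesis by simp
  qed
  define P where "P x = \<Phi> x / W" for x
  have "h n 0 = 0" for n by (simp add: h_def)
  then have "P 0 = 0" by (simp add: P_def \<Phi>_def)
  moreover have "deg1 P"
    unfolding deg1_def P_def using cont less one Wpos
    by (auto simp: strict_mono_def divide_strict_right_mono add_divide_distrib intro!: continuous_on_divide continuous_on_const)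
  moreover have "P (F k y) - P (F k x) \<le> 4 ^ Suc k * (P y - P x)" if "x \<le> y" for k x y
    using divide_right_mono[OF lip[OF that], of W k] Wpos by (simp add: P_def diff_divide_distrib right_diff_distrib)
  ultimately show ?thesis by blast
qed

section \<open>Normalized actions and their limits\<close>

definition lipschitz_weight :: "('g, 'm) monoid_scheme \<Rightarrow> 'g \<Rightarrow> real"
  where "lipschitz_weight G g = 4 ^ Suc (to_nat_on (carrier G) g)"

text \<open>An action given by lifts, hence multiplicative only up to integers. Fixing the value at
  0 in [0, 1) singles out the lifts and keeps them bounded for the compactness argument.\<close>

definition normalized_action :: "('g, 'm) monoid_scheme \<Rightarrow> ('g \<Rightarrow> real \<Rightarrow> real) \<Rightarrow> bool"
  where "normalized_action G F \<longleftrightarrow>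
    (\<forall>g\<in>carrier G. deg1 (F g) \<and> 0 \<le> F g 0 \<and> F g 0 < 1 \<and>
      (\<forall>x y. \<bar>F g x - F g y\<bar> \<le> lipschitz_weight G g * \<bar>x - y\<bar>)) \<and>
    (\<forall>g\<in>carrier G. \<forall>h\<in>carrier G. \<exists>c::int. \<forall>x. F g (F h x) = F (g \<otimes>\<^bsub>G\<^esub> h) x + of_int c)"

text \<open>The lifts are conjugated by the coordinate of \<open>lipschitz_coordinate\<close>. It
  fixes 0 and thereby preserves the normalization, and conjugation preserves translation
  numbers.\<close>

lemma normalized_action_exists:
  assumes G: "group G" "countable (carrier G)" and \<rho>: "\<rho> \<in> hom G homeo_circle_plus"
  shows "\<exists>F. normalized_action G F \<and> (\<forall>g\<in>carrier G. rot (\<rho> g) = to_circle (trans_num (F g)))"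
proof -
  have "\<exists>L. deg1 L \<and> 0 \<le> L 0 \<and> L 0 < 1 \<and> (g \<in> carrier G \<longrightarrow> circ L = \<rho> g)" for g
  proof (cases "g \<in> carrier G")
    case True
    then obtain L where L: "deg1 L" "\<rho> g = circ L"
      using hom_in_carrier[OF \<rho>] by (force simp: carrier_homeo_circle_plus)
    define L' where "L' = (\<lambda>x. L x + of_int (- \<lfloor>L 0\<rfloor>))"
    have "deg1 L'" unfolding L'_def by (rule deg1_shift[OF L(1)])
    moreover have "circ L' = \<rho> g" unfolding L'_def L(2) by (rule circ_add_int[OF L(1)])
    moreover have "0 \<le> L' 0" "L' 0 < 1" unfolding L'_def of_int_minus by linarith+
    ultimately show ?thesis by blast
  next
    case False
    then show ?thesis by (intro exI[of _ "\<lambda>x. x"]) simp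
  qed
  then obtain L where L: "\<And>g. deg1 (L g)" "\<And>g. 0 \<le> L g 0" "\<And>g. L g 0 < 1"
    "\<And>g. g \<in> carrier G \<Longrightarrow> circ (L g) = \<rho> g" by metis
  obtain P where P: "deg1 P" "P 0 = 0"
    "\<And>k x y. x \<le> y \<Longrightarrow> P (L (from_nat_into (carrier G) k) y) - P (L (from_nat_into (carrier G) k) x) \<le> 4 ^ Suc k * (P y - P x)"
    using lipschitz_coordinate[of "\<lambda>k. L (from_nat_into (carrier G) k)"] L(1) by metis
  obtain Q where Q: "deg1 Q" "\<And>x. P (Q x) = x" "\<And>x. Q (P x) = x"
    using deg1_inverse[OF P(1)] by metis
  have Q0: "Q 0 = 0" using Q(3)[of 0] P(2) by simp
  define F where "F g = P \<circ> L g \<circ> Q" for g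
  have F: "deg1 (F g)" for g unfolding F_def by (intro deg1_compose P Q L)
  have "normalized_action G F"
    unfolding normalized_action_def
  proof (intro conjI ballI allI)
    fix g assume g: "g \<in> carrier G"
    show "deg1 (F g)" by (rule F)
    have "P 0 \<le> P (L g 0)" "P (L g 0) < P (0 + 1)"
      using L(2,3) deg1_le_iff[OF P(1)] deg1_less_iff[OF P(1)] by simp_all
    then show "0 \<le> F g 0" "F g 0 < 1" using P(2) deg1_one[OF P(1), of 0] by (simp_all add: F_def Q0)
    have idx: "from_nat_into (carrier G) (to_nat_on (carrier G) g) = g"
      using G(2) g by simp
    have le: "F g y - F g x \<le> lipschitz_weight G g * (y - x)" if "x \<le> y" for x y
      using P(3)[of "Q x" "Q y" "to_nat_on (carrier G) g"] that
      unfolding idx by (simp add: F_def lipschitz_weight_def deg1_le_iff[OF Q(1)] Q(2))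
    show "\<bar>F g x - F g y\<bar> \<le> lipschitz_weight G g * \<bar>x - y\<bar>" for x y
    proof (cases "x \<le> y")
      case True
      then have "F g x \<le> F g y" by (simp add: deg1_le_iff[OF F])
      then show ?thesis using le[OF True] True by (simp add: abs_if)
    next
      case False
      then have "F g y \<le> F g x" by (simp add: deg1_le_iff[OF F])
      then show ?thesis using le[of y x] False by simp
    qed
  next
    fix g h assume g: "g \<in> carrier G" "h \<in> carrier G"
    have gh: "g \<otimes>\<^bsub>G\<^esub> h \<in> carrier G" using monoid.m_closed[OF group.is_monoid[OF G(1)] g] .
    have "circ (L g \<circ> L h) = circ (L (g \<otimes>\<^bsub>G\<^esub> h))"
      using hom_mult[OF \<rho> g] L(4) g gh circ_compose[OF L(1)[of g] L(1)[of h]] by simp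
    then obtain c :: int where c: "\<And>x. (L g \<circ> L h) x = L (g \<otimes>\<^bsub>G\<^esub> h) x + of_int c"
      using circ_eq_iff[OF deg1_compose[OF L(1)[of g] L(1)[of h]] L(1)] by blast
    have "F g (F h x) = F (g \<otimes>\<^bsub>G\<^esub> h) x + of_int c" for x
      using c[of "Q x"] by (simp add: F_def Q(3) deg1_add_int[OF P(1)])
    then show "\<exists>c::int. \<forall>x. F g (F h x) = F (g \<otimes>\<^bsub>G\<^esub> h) x + of_int c" by blast
  qed
  moreover have "rot (\<rho> g) = to_circle (trans_num (F g))" if g: "g \<in> carrier G" for g
  proof -
    have "trans_num (L g) = trans_num (F g)"
      by (rule trans_num_conj[OF L(1) F P(1)]) (simp add: F_def Q)
    then show ?thesis using rot_circ[OF L(1), of g] L(4)[OF g] by simp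
  qed
  ultimately show ?thesis by blast
qed

lemma normalized_action_one:
  assumes G: "group G" and F: "normalized_action G F"
  shows "F \<one>\<^bsub>G\<^esub> x = x"
proof -
  interpret G: group G by (rule G)
  obtain c :: int where c: "\<And>x. F \<one>\<^bsub>G\<^esub> (F \<one>\<^bsub>G\<^esub> x) = F \<one>\<^bsub>G\<^esub> x + of_int c"
    using F G.one_closed unfolding normalized_action_def by (metis G.r_one)
  have d: "deg1 (F \<one>\<^bsub>G\<^esub>)" "0 \<le> F \<one>\<^bsub>G\<^esub> 0" "F \<one>\<^bsub>G\<^esub> 0 < 1"
    using F G.one_closed unfolding normalized_action_def by blast+
  have *: "F \<one>\<^bsub>G\<^esub> y = y + of_int c" for y
    using deg1_surj[OF d(1), of y] c by metis
  have "c = 0" using d(2,3) unfolding * by simp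
  then show ?thesis by (simp add: *)
qed

lemma lifted_action_hom:
  assumes G: "group G" and d: "\<And>g. g \<in> carrier G \<Longrightarrow> deg1 (F g)"
    and law: "\<And>g h. g \<in> carrier G \<Longrightarrow> h \<in> carrier G \<Longrightarrow>
      \<exists>c::int. \<forall>x. F g (F h x) = F (g \<otimes>\<^bsub>G\<^esub> h) x + of_int c"
  shows "(\<lambda>g. circ (F g)) \<in> hom G homeo_circle_plus"
proof (rule homI)
  fix g assume "g \<in> carrier G"
  then show "circ (F g) \<in> carrier homeo_circle_plus" by (intro circ_in_carrier d)
next
  fix g h assume g: "g \<in> carrier G" "h \<in> carrier G"
  have gh: "g \<otimes>\<^bsub>G\<^esub> h \<in> carrier G" using monoid.m_closed[OF group.is_monoid[OF G] g] .
  have "\<exists>c::int. \<forall>x. (F g \<circ> F h) x = F (g \<otimes>\<^bsub>G\<^esub> h) x + of_int c" using law[OF g] by simp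
  then have "circ (F g \<circ> F h) = circ (F (g \<otimes>\<^bsub>G\<^esub> h))"
    using circ_eq_iff[OF deg1_compose[OF d[OF g(1)] d[OF g(2)]] d[OF gh]] by blast
  then show "circ (F (g \<otimes>\<^bsub>G\<^esub> h)) = circ (F g) \<otimes>\<^bsub>homeo_circle_plus\<^esub> circ (F h)"
    using circ_compose[OF d[OF g(1)] d[OF g(2)]] by simp
qed

text \<open>The index \<open>p\<close> will run over pairs of a group element and a real number, so
  a subsequence converging at every \<open>p\<close> cannot be expected. Tychonoff's theorem gives a
  cluster point, and the preimages of its neighbourhoods refine \<open>sequentially\<close> to a
  filter along which all coordinates converge.\<close>

lemma cluster_filter:
  fixes X :: "nat \<Rightarrow> 'p \<Rightarrow> real"
  assumes X: "\<And>i p. X i p \<in> {a..b}"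
  shows "\<exists>\<F> Y. \<F> \<noteq> bot \<and> \<F> \<le> sequentially \<and> (\<forall>p. ((\<lambda>i. X i p) \<longlongrightarrow> Y p) \<F>)"
proof -
  define U where "U = (PiE UNIV (\<lambda>_. {a..b}) :: ('p \<Rightarrow> real) set)"
  have "compactin (product_topology (\<lambda>_. euclidean) UNIV) U"
    unfolding U_def compactin_PiE by simp
  then have "compact U" by (simp add: euclidean_product_topology)
  moreover have "filtermap X sequentially \<noteq> bot" by (simp add: filtermap_bot_iff)
  moreover have "eventually (\<lambda>x. x \<in> U) (filtermap X sequentially)"
    unfolding eventually_filtermap U_def by (intro always_eventually allI PiE_I X) simp
  ultimately obtain Y where Y: "inf (nhds Y) (filtermap X sequentially) \<noteq> bot"
    unfolding compact_filter by blast
  define \<F> where "\<F> = inf sequentially (filtercomap X (nhds Y))"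
  have "\<F> \<noteq> bot"
  proof
    assume "\<F> = bot"
    then obtain A B where AB: "eventually A sequentially" "eventually B (filtercomap X (nhds Y))" "\<And>i. A i \<Longrightarrow> B i \<Longrightarrow> False"
      unfolding \<F>_def trivial_limit_def eventually_inf by blast
    obtain R where R: "eventually R (nhds Y)" "\<And>i. R (X i) \<Longrightarrow> B i"
      using AB(2) unfolding eventually_filtercomap by blast
    have "eventually (\<lambda>z. \<not> R z) (filtermap X sequentially)"
      unfolding eventually_filtermap using AB(1) by eventually_elim (use AB(3) R(2) in blast)
    then have "eventually (\<lambda>_. False) (inf (nhds Y) (filtermap X sequentially))"
      using R(1) unfolding eventually_inf by blast
    then show False using Y by (simp add: trivial_limit_def)
  qed
  moreover have "\<F> \<le> sequentially" by (simp add: \<F>_def)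
  moreover have "((\<lambda>i. X i p) \<longlongrightarrow> Y p) \<F>" for p
  proof -
    have "filterlim X (nhds Y) \<F>"
      unfolding \<F>_def by (rule filterlim_mono[OF filterlim_filtercomap order_refl inf_le2])
    then have XY: "eventually (\<lambda>i. X i \<in> S) \<F>" if "open S" "Y \<in> S" for S
      using that by (rule topological_tendstoD)
    show ?thesis
    proof (rule topological_tendstoI)
      fix S :: "real set" assume S: "open S" "Y p \<in> S"
      have "open ((\<lambda>x :: 'p \<Rightarrow> real. x p) -` S)"
        by (rule open_vimage[OF S(1) continuous_on_product_coordinates])
      from XY[OF this] show "eventually (\<lambda>i. X i p \<in> S) \<F>" using S(2) by simp
    qed
  qed
  ultimately show ?thesis by blast
qed

text \<open>The common Lipschitz constant allows the argument to vary with the map; pointwise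
  convergence alone would not.\<close>

lemma tendsto_lipschitz_compose:
  fixes K :: real and f :: "'i \<Rightarrow> real \<Rightarrow> real"
  assumes lip: "\<And>i x y. \<bar>f i x - f i y\<bar> \<le> K * \<bar>x - y\<bar>"
    and f: "\<And>x. ((\<lambda>i. f i x) \<longlongrightarrow> \<phi> x) \<F>" and u: "(u \<longlongrightarrow> y) \<F>"
  shows "((\<lambda>i. f i (u i)) \<longlongrightarrow> \<phi> y) \<F>"
proof -
  have "((\<lambda>i. f i (u i) - f i y) \<longlongrightarrow> 0) \<F>"
  proof (rule Lim_null_comparison)
    show "\<forall>\<^sub>F i in \<F>. norm (f i (u i) - f i y) \<le> K * \<bar>u i - y\<bar>" using lip by simp
    show "((\<lambda>i. K * \<bar>u i - y\<bar>) \<longlongrightarrow> 0) \<F>"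
      using tendsto_mult[OF tendsto_const tendsto_rabs[OF tendsto_diff[OF u tendsto_const]], of K y] by simp
  qed
  from tendsto_add[OF this f[of y]] show ?thesis by simp
qed

text \<open>The integer defects of the group law converge, and since they do not involve
  \<open>x\<close>, neither does their limit, again an integer. Limits of increasing maps are only
  weakly increasing; strictness comes from the limit at the inverse element, which undoes
  \<open>E g\<close> up to an integer.\<close>

lemma normalized_action_limit:
  assumes G: "group G" and F: "\<And>i. normalized_action G (F i)" and \<F>: "\<F> \<noteq> bot"
    and lim: "\<And>g x. g \<in> carrier G \<Longrightarrow> ((\<lambda>i. F i g x) \<longlongrightarrow> E g x) \<F>"
  shows "\<forall>g\<in>carrier G. deg1 (E g)"
    "\<forall>g\<in>carrier G. \<forall>h\<in>carrier G. \<exists>c::int. \<forall>x. E g (E h x) = E (g \<otimes>\<^bsub>G\<^esub> h) x + of_int c"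
proof -
  interpret G: group G by (rule G)
  have d: "deg1 (F i g)" and lip: "\<bar>F i g x - F i g y\<bar> \<le> lipschitz_weight G g * \<bar>x - y\<bar>"
    if "g \<in> carrier G" for i g x y
    using F that unfolding normalized_action_def by blast+
  have law: "\<exists>c::int. \<forall>x. E g (E h x) = E (g \<otimes>\<^bsub>G\<^esub> h) x + of_int c"
    if g: "g \<in> carrier G" "h \<in> carrier G" for g h
  proof -
    have "\<forall>i. \<exists>c::int. \<forall>x. F i g (F i h x) = F i (g \<otimes>\<^bsub>G\<^esub> h) x + of_int c"
      using F g unfolding normalized_action_def by blast
    then obtain c :: "_ \<Rightarrow> int" where c: "\<And>i x. F i g (F i h x) = F i (g \<otimes>\<^bsub>G\<^esub> h) x + of_int (c i)" by metis
    have conv: "((\<lambda>i. real_of_int (c i)) \<longlongrightarrow> E g (E h x) - E (g \<otimes>\<^bsub>G\<^esub> h) x) \<F>" for x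
    proof -
      have "((\<lambda>i. F i g (F i h x)) \<longlongrightarrow> E g (E h x)) \<F>"
        by (rule tendsto_lipschitz_compose[OF lip[OF g(1)] lim[OF g(1)] lim[OF g(2)]])
      from tendsto_diff[OF this lim[OF G.m_closed[OF g]], of x] show ?thesis by (simp add: c)
    qed
    have "E g (E h 0) - E (g \<otimes>\<^bsub>G\<^esub> h) 0 \<in> \<int>"
      by (rule Lim_in_closed_set[OF closed_Ints _ \<F> conv]) simp
    then obtain k where k: "E g (E h 0) - E (g \<otimes>\<^bsub>G\<^esub> h) 0 = of_int k" by (auto elim: Ints_cases)
    have "E g (E h x) = E (g \<otimes>\<^bsub>G\<^esub> h) x + of_int k" for x
      using tendsto_unique[OF \<F> conv[of x] conv[of 0]] k by simp
    then show ?thesis by blast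
  qed
  then show "\<forall>g\<in>carrier G. \<forall>h\<in>carrier G. \<exists>c::int. \<forall>x. E g (E h x) = E (g \<otimes>\<^bsub>G\<^esub> h) x + of_int c" by blast
  have E1: "E \<one>\<^bsub>G\<^esub> x = x" for x
    using tendsto_unique[OF \<F> lim[OF G.one_closed, of x], of x] normalized_action_one[OF G F] by simp
  have "deg1 (E g)" if g: "g \<in> carrier G" for g
  proof -
    have "E g (x + 1) = E g x + 1" for x
    proof -
      have "((\<lambda>i. F i g (x + 1)) \<longlongrightarrow> E g x + 1) \<F>"
        unfolding deg1_one[OF d[OF g]] by (intro tendsto_add lim[OF g] tendsto_const)
      then show ?thesis using tendsto_unique[OF \<F> lim[OF g]] by blast
    qed
    moreover have "\<bar>E g x - E g y\<bar> \<le> lipschitz_weight G g * \<bar>x - y\<bar>" for x y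
      by (rule tendsto_upperbound[OF tendsto_rabs[OF tendsto_diff[OF lim[OF g] lim[OF g]]] _ \<F>])
        (use lip[OF g] in simp)
    then have "continuous_on UNIV (E g)"
      by (intro lipschitz_on_continuous_on[of "lipschitz_weight G g"] lipschitz_onI)
        (auto simp: dist_real_def lipschitz_weight_def)
    moreover have "strict_mono (E g)"
    proof (rule strict_monoI)
      fix x y :: real assume xy: "x < y"
      have "E g x \<le> E g y"
        by (rule tendsto_le[OF \<F> lim[OF g] lim[OF g]]) (use xy d[OF g] in \<open>simp add: deg1_le_iff\<close>)
      moreover have "E g x \<noteq> E g y"
      proof
        assume eq: "E g x = E g y"
        obtain c :: int where "\<And>x. E (inv\<^bsub>G\<^esub> g) (E g x) = E (inv\<^bsub>G\<^esub> g \<otimes>\<^bsub>G\<^esub> g) x + of_int c"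
          using law[OF G.inv_closed[OF g] g] by blast
        then have "x + of_int c = y + of_int c" using eq E1 G.l_inv[OF g] by metis
        then show False using xy by simp
      qed
      ultimately show "E g x < E g y" by simp
    qed
    ultimately show ?thesis by (simp add: deg1_def)
  qed
  then show "\<forall>g\<in>carrier G. deg1 (E g)" by blast
qed

text \<open>For a fixed \<open>n\<close> the \<open>n\<close>-th iterates converge, and dividing
  them by \<open>n\<close> gives the translation numbers up to 1/n. The three errors of size 1
  explain the choice of \<open>n\<close> above 3/e.\<close>

lemma trans_num_tendsto:
  assumes F: "\<And>i. deg1 (F i)" and E: "deg1 E"
    and lip: "\<And>i x y. \<bar>F i x - F i y\<bar> \<le> K * \<bar>x - y\<bar>"
    and lim: "\<And>x. ((\<lambda>i. F i x) \<longlongrightarrow> E x) \<F>"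
  shows "((\<lambda>i. trans_num (F i)) \<longlongrightarrow> trans_num E) \<F>"
proof (rule tendstoI)
  fix e :: real assume e: "e > 0"
  have pow: "((\<lambda>i. (F i ^^ n) 0) \<longlongrightarrow> (E ^^ n) 0) \<F>" for n
  proof (induction n)
    case (Suc n)
    then show ?case using tendsto_lipschitz_compose[OF lip lim Suc] by simp
  qed simp
  obtain n where n: "3 / e < real n" using reals_Archimedean2 by blast
  have "0 < 3 / e" using e by simp
  then have n0: "real n > 0" using n by linarith
  from tendstoD[OF pow[of n], of 1]
  have "\<forall>\<^sub>F i in \<F>. dist ((F i ^^ n) 0) ((E ^^ n) 0) < 1" by simp
  then show "\<forall>\<^sub>F i in \<F>. dist (trans_num (F i)) (trans_num E) < e"
  proof eventually_elim
    case (elim i)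
    then have "\<bar>real n * trans_num (F i) - real n * trans_num E\<bar> \<le> 3"
      using trans_num_bound[OF F, of n i] trans_num_bound[OF E, of n] by (simp add: dist_real_def)
    then have "real n * \<bar>trans_num (F i) - trans_num E\<bar> \<le> 3"
      using n0 by (simp add: right_diff_distrib[symmetric] abs_mult)
    then have "\<bar>trans_num (F i) - trans_num E\<bar> \<le> 3 / real n" using n0 by (simp add: field_simps)
    also have "\<dots> < e" using n n0 e by (simp add: field_simps)
    finally show ?case by (simp add: dist_real_def)
  qed
qed

lemma closed_rot_X:
  assumes G: "group G" "countable (carrier G)" and a: "a \<in> carrier G"
  shows "closed (rot_X G a)"
  unfolding closed_circle_iff closed_sequential_limits
proof (intro allI impI, elim conjE)
  fix x :: "nat \<Rightarrow> real" and l
  assume x: "\<forall>n. x n \<in> to_circle -` rot_X G a" and l: "x \<longlonglongrightarrow> l"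
  have "\<exists>F. normalized_action G F \<and> to_circle (x n) = to_circle (trans_num (F a))" for n
  proof -
    obtain \<rho> where "\<rho> \<in> hom G homeo_circle_plus" "to_circle (x n) = rot (\<rho> a)"
      using x by (auto simp: rot_X_def)
    then show ?thesis using normalized_action_exists[OF G] a by metis
  qed
  then obtain F where F: "\<And>n. normalized_action G (F n)" "\<And>n. to_circle (x n) = to_circle (trans_num (F n a))" by metis
  \<comment> \<open>Displacements, unlike values, lie in an interval independent of
    \<open>t\<close>: they differ by less than 1 from the value at 0, which is in [0, 1).\<close>
  define X where "X n = (\<lambda>(g, t). if g \<in> carrier G then F n g t - t else 0)" for n
  have "X n p \<in> {-1..2}" for n p
  proof (cases p)
    case (Pair g t)
    show ?thesis
    proof (cases "g \<in> carrier G")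
      case True
      then have "deg1 (F n g)" "0 \<le> F n g 0" "F n g 0 < 1" using F(1) unfolding normalized_action_def by blast+
      then have "- 1 \<le> F n g t - t" "F n g t - t \<le> 2" using deg1_displacement[of "F n g" t 0] by linarith+
      then show ?thesis using True Pair by (simp add: X_def)
    qed (simp add: X_def Pair)
  qed
  then obtain \<F> Y where \<F>: "\<F> \<noteq> bot" "\<F> \<le> sequentially" and Y: "\<And>p. ((\<lambda>n. X n p) \<longlongrightarrow> Y p) \<F>"
    using cluster_filter[of X "-1" 2] by blast
  define E where "E g t = Y (g, t) + t" for g t
  have lim: "((\<lambda>n. F n g t) \<longlongrightarrow> E g t) \<F>" if "g \<in> carrier G" for g t
    using tendsto_add[OF Y[of "(g, t)"] tendsto_const, of t] that by (simp add: X_def E_def)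
  have E: "deg1 (E g)" if "g \<in> carrier G" for g
    using normalized_action_limit(1)[OF G(1) F(1) \<F>(1) lim] that by blast
  have law: "\<exists>c::int. \<forall>x. E g (E h x) = E (g \<otimes>\<^bsub>G\<^esub> h) x + of_int c"
    if "g \<in> carrier G" "h \<in> carrier G" for g h
    using normalized_action_limit(2)[OF G(1) F(1) \<F>(1) lim] that by blast
  have "((\<lambda>n. trans_num (F n a)) \<longlongrightarrow> trans_num (E a)) \<F>"
  proof (rule trans_num_tendsto)
    show "deg1 (F n a)" "\<bar>F n a s - F n a t\<bar> \<le> lipschitz_weight G a * \<bar>s - t\<bar>" for n s t
      using F(1)[of n] a unfolding normalized_action_def by blast+
  qed (use E lim a in auto)
  from tendsto_diff[OF this tendsto_mono[OF \<F>(2) l]]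
  have conv: "((\<lambda>n. trans_num (F n a) - x n) \<longlongrightarrow> trans_num (E a) - l) \<F>" .
  have "trans_num (E a) - l \<in> \<int>"
    by (rule Lim_in_closed_set[OF closed_Ints _ \<F>(1) conv])
      (use F(2) in \<open>auto simp: to_circle_eq_iff[symmetric]\<close>)
  then have "to_circle l = rot (circ (E a))"
    using rot_circ[OF E[OF a]] by (simp add: to_circle_eq_iff[symmetric])
  then show "l \<in> to_circle -` rot_X G a"
    using rot_XI[OF lifted_action_hom[OF G(1) E law]] by simp
qed

section \<open>The representation topology\<close>

lemma to_circle_vimage_zero: "to_circle -` {0} = \<int>"
  by (auto simp: to_circle_eq_0_iff)

theorem corollaryD:
  "\<exists>T :: circle topology.
     topspace T = UNIV \<and>
     (\<forall>(G :: 'g monoid) a. group G \<and> countable (carrier G) \<and> a \<in> carrier G \<longrightarrow>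
        rot_X G a \<noteq> {} \<and> closedin T (rot_X G a)) \<and>
     (\<forall>C. C \<noteq> {} \<and> closedin T C \<longrightarrow>
        (\<exists>(G :: nat monoid) a. group G \<and> countable (carrier G) \<and> a \<in> carrier G \<and> C = rot_X G a)) \<and>
     (\<forall>C. C \<noteq> {} \<and> closedin T C \<longleftrightarrow>
        (\<exists>K. closed K \<and> uminus ` K = K \<and> C = {0} \<union> K))"
proof -
  \<comment> \<open>Complements of closed symmetric sets containing 0, together with the whole
    circle, which is listed separately because the empty set must be closed without containing
    0.\<close>
  define L where "L U \<longleftrightarrow> U = UNIV \<or> 0 \<notin> U \<and> open U \<and> (\<forall>c\<in>U. - c \<in> U)" for U :: "circle set"
  define T where "T = topology L"
  have "istopology L"
    unfolding istopology_def
  proof (intro conjI allI impI)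
    show "L (A \<inter> B)" if "L A" "L B" for A B using that by (auto simp: L_def)
    show "L (\<Union> \<A>)" if A: "\<forall>A\<in>\<A>. L A" for \<A>
    proof (cases "UNIV \<in> \<A>")
      case True
      then show ?thesis by (auto simp: L_def)
    next
      case False
      then have "\<forall>A\<in>\<A>. 0 \<notin> A \<and> open A \<and> (\<forall>c\<in>A. - c \<in> A)" using A unfolding L_def by metis
      then show ?thesis unfolding L_def by blast
    qed
  qed
  then have openT: "openin T U \<longleftrightarrow> L U" for U by (simp add: T_def)
  have top: "topspace T = UNIV"
    using openin_subset[of T UNIV] by (auto simp: openT L_def)
  have closedT: "closedin T C \<and> C \<noteq> {} \<longleftrightarrow> closed C \<and> 0 \<in> C \<and> (\<forall>c\<in>C. - c \<in> C)" for C
  proof -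
    have "(\<forall>c\<in>- C. - c \<in> - C) \<longleftrightarrow> (\<forall>c\<in>C. - c \<in> C)" by (metis ComplD ComplI minus_minus)
    moreover have "- C = UNIV \<longleftrightarrow> C = {}" by blast
    ultimately show ?thesis
      unfolding closedin_def top openT L_def Compl_eq_Diff_UNIV[symmetric] closed_def by auto
  qed
  have sym: "uminus ` C = C \<longleftrightarrow> (\<forall>c\<in>C. - c \<in> C)" for C :: "circle set"
    by (metis (no_types, opaque_lifting) image_eqI image_subsetI minus_minus subset_antisym subsetI imageI)
  have zero: "closed {0 :: circle}"
    unfolding closed_circle_iff to_circle_vimage_zero by (rule closed_Ints)
  have K: "C \<noteq> {} \<and> closedin T C \<longleftrightarrow> (\<exists>K. closed K \<and> uminus ` K = K \<and> C = {0} \<union> K)" for C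
  proof
    assume "C \<noteq> {} \<and> closedin T C"
    then have "closed C" "0 \<in> C" "uminus ` C = C" using closedT[of C] sym by auto
    then show "\<exists>K. closed K \<and> uminus ` K = K \<and> C = {0} \<union> K" by (intro exI[of _ C]) auto
  next
    assume "\<exists>K. closed K \<and> uminus ` K = K \<and> C = {0} \<union> K"
    then obtain K where K: "closed K" "\<forall>c\<in>K. - c \<in> K" "C = {0} \<union> K" using sym by metis
    then have "closed C" using closed_Un[OF zero K(1)] by simp
    moreover have "0 \<in> C" "\<forall>c\<in>C. - c \<in> C" using K by auto
    ultimately show "C \<noteq> {} \<and> closedin T C" using closedT[of C] by blast
  qed
  have rotX: "rot_X G a \<noteq> {} \<and> closedin T (rot_X G a)"
    if "group G" "countable (carrier G)" "a \<in> carrier G" for G :: "'g monoid" and a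
  proof -
    have "\<forall>c\<in>rot_X G a. - c \<in> rot_X G a" using rot_X_uminus[OF that(3)] by (rule ballI)
    then show ?thesis using closedT[of "rot_X G a"] closed_rot_X[OF that] zero_in_rot_X[of G a] by simp
  qed
  have realize: "\<exists>(N :: nat monoid) b. group N \<and> countable (carrier N) \<and> b \<in> carrier N \<and> C = rot_X N b"
    if C: "C \<noteq> {} \<and> closedin T C" for C
  proof -
    have "closed C" "0 \<in> C" "uminus ` C = C" using closedT[of C] C sym by auto
    then obtain G :: "(real \<Rightarrow> circle \<Rightarrow> circle) monoid" and a
      where G: "group G" "countable (carrier G)" "a \<in> carrier G" "rot_X G a = C"
      using closed_symmetric_realized by metis
    show ?thesis using countable_group_nat[OF G(1-3)] G(4) by metis
  qed
  show ?thesis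
  proof (intro exI[of _ T] conjI)
    show "topspace T = UNIV" by (rule top)
    show "\<forall>(G :: 'g monoid) a. group G \<and> countable (carrier G) \<and> a \<in> carrier G \<longrightarrow>
        rot_X G a \<noteq> {} \<and> closedin T (rot_X G a)"
      using rotX by blast
    show "\<forall>C. C \<noteq> {} \<and> closedin T C \<longrightarrow>
        (\<exists>(G :: nat monoid) a. group G \<and> countable (carrier G) \<and> a \<in> carrier G \<and> C = rot_X G a)"
      using realize by blast
    show "\<forall>C. C \<noteq> {} \<and> closedin T C \<longleftrightarrow> (\<exists>K. closed K \<and> uminus ` K = K \<and> C = {0} \<union> K)"
      by (rule allI) (rule K)
  qed
qed

end
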